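(* Let $\{h_r\ (r \text{ simple}),\ e_r\ (r\in E_6)\}$ be a Chevalley basis of the complex simple Lie algebra of type $E_6$, with structure constants $N_{r,s}$ defined by $[e_r,e_s]=N_{r,s}e_{r+s}$, and suppose that the structure constants of the 30 extraspecial pairs are the following signs, where $\alpha_0,\dots,\alpha_9,\beta_1,\dots,\beta_9,\gamma_1,\dots,\gamma_6,\delta_1,\delta_2,\delta_3,\epsilon_1,\epsilon_2\in\{1,-1\}$: $N_{a,c}=\alpha_1$, $N_{a,c+d}=\alpha_2$, $N_{a,b+c+d}=\alpha_3$, $N_{a,c+d+e}=\alpha_4$, $N_{a,b+c+d+e}=\alpha_5$, $N_{a,b+c+2d+e}=\alpha_6$, $N_{a,c+d+e+f}=\alpha_7$, $N_{a,b+c+d+e+f}=\alpha_8$, $N_{a,b+c+2d+e+f}=\alpha_9$, $N_{a,b+c+2d+2e+f}=\alpha_0$; $N_{c,d}=\beta_1$, $N_{c,b+d}=\beta_2$, $N_{c,d+e}=\beta_3$, $N_{c,b+d+e}=\beta_4$, $N_{c,a+b+c+2d+e}=\beta_5$, $N_{c,d+e+f}=\beta_6$, $N_{c,b+d+e+f}=\beta_7$, $N_{c,a+b+c+2d+e+f}=\beta_8$, $N_{c,a+b+c+2d+2e+f}=\beta_9$; $N_{d,b}=\gamma_1$, $N_{d,e}=\gamma_2$, $N_{d,b+c+d+e}=\gamma_3$, $N_{d,e+f}=\gamma_4$, $N_{d,b+c+d+e+f}=\gamma_5$, $N_{d,a+b+2c+2d+2e+f}=\gamma_6$; $N_{b,d+e}=\delta_1$,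 $N_{b,d+e+f}=\delta_2$, $N_{b,a+b+2c+3d+2e+f}=\delta_3$; $N_{e,f}=\epsilon_1$, $N_{e,b+c+2d+e+f}=\epsilon_2$. Then the non-zero structure constants $N_{r,s}$ and $N_{r,-s}$ with $0\prec r\prec s$ are as follows. (A) The non-zero $N_{r,s}$ with $0\prec r\prec s$ are the 30 constants above together with the following 90: $r=a+c$: $N_{r,d}=\alpha_{12}\beta_1$, $N_{r,b+d}=\alpha_{13}\beta_2$, $N_{r,d+e}=\alpha_{14}\beta_3$, $N_{r,b+d+e}=\alpha_{15}\beta_4$, $N_{r,b+c+2d+e}=-\alpha_{16}\beta_5$, $N_{r,d+e+f}=\alpha_{17}\beta_6$, $N_{r,b+d+e+f}=\alpha_{18}\beta_7$, $N_{r,b+c+2d+e+f}=-\alpha_{19}\beta_8$, $N_{r,b+c+2d+2e+f}=-\alpha_{10}\beta_9$. $r=d$: $N_{r,a+b+c+d+e}=\alpha_{56}\gamma_3$, $N_{r,a+b+c+d+e+f}=\alpha_{89}\gamma_5$. $r=c+d$: $N_{r,b}=\beta_{12}\gamma_1$, $N_{r,e}=\beta_{13}\gamma_2$, $N_{r,b+d+e}=-\beta_{14}\gamma_3$, $N_{r,a+b+c+d+e}=\alpha_{56}\beta_{15}\gamma_3$, $N_{r,e+f}=\beta_{16}\gamma_4$, $N_{r,b+d+e+f}=-\beta_{17}\gamma_5$, $N_{r,a+b+c+d+e+f}=\alpha_{89}\beta_{18}\gamma_5$, $N_{r,a+b+c+2d+2e+f}=-\beta_{19}\gamma_6$. $r=a+c+d$: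 $N_{r,b}=\alpha_{23}\beta_{12}\gamma_1$, $N_{r,e}=\alpha_{24}\beta_{13}\gamma_2$, $N_{r,b+d+e}=-\alpha_{26}\beta_{14}\gamma_3$, $N_{r,b+c+d+e}=-\alpha_{26}\beta_{15}\gamma_3$, $N_{r,e+f}=\alpha_{27}\beta_{16}\gamma_4$, $N_{r,b+d+e+f}=-\alpha_{29}\beta_{17}\gamma_5$, $N_{r,b+c+d+e+f}=-\alpha_{29}\beta_{18}\gamma_5$, $N_{r,b+c+2d+2e+f}=\alpha_{20}\beta_{19}\gamma_6$. $r=b$: $N_{r,c+d+e}=\beta_{34}\delta_1$, $N_{r,a+c+d+e}=\alpha_{45}\beta_{34}\delta_1$, $N_{r,c+d+e+f}=\beta_{67}\delta_2$, $N_{r,a+c+d+e+f}=\alpha_{78}\beta_{67}\delta_2$. $r=b+d$: $N_{r,e}=-\gamma_{12}\delta_1$, $N_{r,c+d+e}=\beta_{34}\gamma_{13}\delta_1$, $N_{r,a+c+d+e}=\alpha_{46}\beta_{34}\gamma_{13}\delta_1$, $N_{r,e+f}=-\gamma_{14}\delta_2$, $N_{r,c+d+e+f}=\beta_{67}\gamma_{15}\delta_2$, $N_{r,a+c+d+e+f}=\alpha_{79}\beta_{67}\gamma_{15}\delta_2$, $N_{r,a+b+2c+2d+2e+f}=-\gamma_{16}\delta_3$. $r=b+c+d$: $N_{r,e}=-\beta_{24}\gamma_{12}\delta_1$, $N_{r,d+e}=-\beta_{24}\gamma_{13}\delta_1$, $N_{r,a+c+d+e}=\alpha_{46}\beta_{2345}\gamma_{13}\delta_1$,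 $N_{r,e+f}=-\beta_{27}\gamma_{14}\delta_2$, $N_{r,d+e+f}=-\beta_{27}\gamma_{15}\delta_2$, $N_{r,a+c+d+e+f}=\alpha_{79}\beta_{2678}\gamma_{15}\delta_2$, $N_{r,a+b+c+2d+2e+f}=\beta_{29}\gamma_{16}\delta_3$. $r=a+b+c+d$: $N_{r,e}=-\alpha_{35}\beta_{24}\gamma_{12}\delta_1$, $N_{r,d+e}=-\alpha_{36}\beta_{24}\gamma_{13}\delta_1$, $N_{r,c+d+e}=-\alpha_{36}\beta_{2345}\gamma_{13}\delta_1$, $N_{r,e+f}=-\alpha_{38}\beta_{27}\gamma_{14}\delta_2$, $N_{r,d+e+f}=-\alpha_{39}\beta_{27}\gamma_{15}\delta_2$, $N_{r,c+d+e+f}=-\alpha_{39}\beta_{2678}\gamma_{15}\delta_2$, $N_{r,b+c+2d+2e+f}=-\alpha_{30}\beta_{29}\gamma_{16}\delta_3$. $r=e$: $N_{r,a+b+c+2d+e+f}=\alpha_{90}\epsilon_2$, $N_{r,a+b+2c+2d+e+f}=\alpha_{90}\beta_{89}\epsilon_2$. $r=d+e$: $N_{r,f}=\gamma_{24}\epsilon_1$, $N_{r,b+c+d+e+f}=-\gamma_{25}\epsilon_2$, $N_{r,a+b+c+d+e+f}=-\alpha_{80}\gamma_{25}\epsilon_2$, $N_{r,a+b+2c+2d+e+f}=\alpha_{90}\beta_{89}\gamma_{26}\epsilon_2$. $r=c+d+e$: $N_{r,f}=\beta_{36}\gamma_{24}\epsilon_1$, $N_{r,b+d+e+f}=\beta_{37}\gamma_{25}\epsilon_2$,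 $N_{r,a+b+c+d+e+f}=-\alpha_{80}\beta_{39}\gamma_{25}\epsilon_2$, $N_{r,a+b+c+2d+e+f}=-\alpha_{90}\beta_{39}\gamma_{26}\epsilon_2$. $r=a+c+d+e$: $N_{r,f}=\alpha_{47}\beta_{36}\gamma_{24}\epsilon_1$, $N_{r,b+d+e+f}=\alpha_{40}\beta_{37}\gamma_{25}\epsilon_2$, $N_{r,b+c+d+e+f}=\alpha_{40}\beta_{39}\gamma_{25}\epsilon_2$, $N_{r,b+c+2d+e+f}=\alpha_{40}\beta_{39}\gamma_{26}\epsilon_2$. $r=b+d+e$: $N_{r,f}=\gamma_{24}\delta_{12}\epsilon_1$, $N_{r,c+d+e+f}=\beta_{67}\gamma_{25}\delta_{12}\epsilon_2$, $N_{r,a+c+d+e+f}=\alpha_{70}\beta_{67}\gamma_{25}\delta_{12}\epsilon_2$, $N_{r,a+b+2c+2d+e+f}=\alpha_{90}\beta_{89}\gamma_{26}\delta_{13}\epsilon_2$. $r=b+c+d+e$: $N_{r,f}=\beta_{47}\gamma_{24}\delta_{12}\epsilon_1$, $N_{r,d+e+f}=-\beta_{47}\gamma_{25}\delta_{12}\epsilon_2$, $N_{r,a+c+d+e+f}=\alpha_{70}\beta_{4679}\gamma_{25}\delta_{12}\epsilon_2$, $N_{r,a+b+c+2d+e+f}=-\alpha_{90}\beta_{49}\gamma_{26}\delta_{13}\epsilon_2$. $r=a+b+c+d+e$: $N_{r,f}=\alpha_{58}\beta_{47}\gamma_{24}\delta_{12}\epsilon_1$, $N_{r,d+e+f}=-\alpha_{50}\beta_{47}\gamma_{25}\delta_{12}\epsilon_2$,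 $N_{r,c+d+e+f}=-\alpha_{50}\beta_{4679}\gamma_{25}\delta_{12}\epsilon_2$, $N_{r,b+c+2d+e+f}=\alpha_{50}\beta_{49}\gamma_{26}\delta_{13}\epsilon_2$. $r=b+c+2d+e$: $N_{r,f}=\beta_{47}\gamma_{2345}\delta_{12}\epsilon_1$, $N_{r,e+f}=\beta_{47}\gamma_{2345}\delta_{12}\epsilon_2$, $N_{r,a+c+d+e+f}=\alpha_{70}\beta_{4679}\gamma_{2356}\delta_{12}\epsilon_2$, $N_{r,a+b+c+d+e+f}=\alpha_{80}\beta_{49}\gamma_{2356}\delta_{13}\epsilon_2$. $r=a+b+c+2d+e$: $N_{r,f}=\alpha_{69}\beta_{47}\gamma_{2345}\delta_{12}\epsilon_1$, $N_{r,e+f}=\alpha_{60}\beta_{47}\gamma_{2345}\delta_{12}\epsilon_2$, $N_{r,c+d+e+f}=-\alpha_{60}\beta_{4679}\gamma_{2356}\delta_{12}\epsilon_2$, $N_{r,b+c+d+e+f}=-\alpha_{60}\beta_{49}\gamma_{2356}\delta_{13}\epsilon_2$. $r=a+b+2c+2d+e$: $N_{r,f}=\alpha_{69}\beta_{4578}\gamma_{2345}\delta_{12}\epsilon_1$, $N_{r,e+f}=\alpha_{60}\beta_{4579}\gamma_{2345}\delta_{12}\epsilon_2$, $N_{r,d+e+f}=\alpha_{60}\beta_{4579}\gamma_{2356}\delta_{12}\epsilon_2$, $N_{r,b+d+e+f}=\alpha_{60}\beta_{4579}\gamma_{2356}\delta_{13}\epsilon_2$. (B) The non-zero $N_{r,-s}$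 with $0\prec r\prec s$ are exactly the following 240: for each of the 120 pairs $(p,q)$, $0\prec p\prec q$, whose constant $N_{p,q}$ is given in the 30 hypotheses or in (A), $$N_{p,-(p+q)}=-N_{p,q},\qquad N_{q,-(p+q)}=N_{p,q}.$$
   Context: Root system. In $\mathbb{R}^8$ with orthonormal basis $e_1,\dots,e_8$ (these vectors are used only here), the root system $E_6$ consists of the vectors $\pm e_i\pm e_j$ ($1\le i<j\le 5$) and $\pm\frac12\bigl(e_8-e_7-e_6+\sum_{i=1}^5(-1)^{\nu(i)}e_i\bigr)$ with $\nu(i)\in\{0,1\}$ and $\sum_{i=1}^5\nu(i)$ even. The simple roots are $a=\frac12(e_1+e_8-e_2-e_3-e_4-e_5-e_6-e_7)$, $b=e_1+e_2$, $c=e_2-e_1$, $d=e_3-e_2$, $e=e_4-e_3$, $f=e_5-e_4$. (So the Dynkin diagram is the chain $a,c,d,e,f$ with $b$ attached to $d$.) All roots have squared length 2. Order. On the span of the simple roots, $x\prec y$ means that in the expansion $y-x=\tau_1 f+\tau_2 e+\tau_3 b+\tau_4 d+\tau_5 c+\tau_6 a$ the first non-zero coefficient among $\tau_1,\tau_2,\dots,\tau_6$ (in this order) is positive. The roots $r$ with $0\prec r$ are exactly the positive roots. Extraspecial pairs. An ordered pair of roots $(r,s)$ is special if $0\prec r\prec s$ and $r+s\in E_6$. A special pair $(r,s)$ is extraspecial if $r\preceq r_1$ for every special pair $(r_1,s_1)$ with $r_1+s_1=r+s$. Structure constants. $e_r$ ($r\in E_6$) are the root vectors of a Chevalley basis: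 $[e_r,e_{-r}]=h_r$ is the coroot of $r$, and $[e_r,e_s]=N_{r,s}e_{r+s}$ with $N_{r,s}=\pm1$ when $r,s,r+s\in E_6$; $N_{r,s}=0$ when $r+s$ is not a root and $r+s\neq 0$. These constants satisfy $N_{s,r}=-N_{r,s}$, $N_{r,s}N_{-r,-s}=-1$ when $r+s\in E_6$. Notation. A letter with several index digits means a product: $\theta_{ij\ldots}=\theta_i\theta_j\cdots$; each digit, including $0$, is a separate index, e.g. $\alpha_{12}=\alpha_1\alpha_2$, $\alpha_{10}=\alpha_1\alpha_0$, $\beta_{2345}=\beta_2\beta_3\beta_4\beta_5$. *)

theory Defs
  imports "HOL-Analysis.Analysis"
begin

section \<open>The root system \<open>E\<^sub>6\<close>\<close>

text \<open>
  The index type of \<^typ>\<open>real^8\<close> is the ring of integers modulo 8, so the eighth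
  coordinate is the one with index 0; \<open>unit_vec 1, \<dots>, unit_vec 8\<close> are the eight
  distinct vectors of the standard orthonormal basis.
\<close>

definition unit_vec :: "nat \<Rightarrow> real^8" where
  "unit_vec i = axis (of_nat i) 1"

definition E6 :: "(real^8) set" where
  "E6 =
     {\<sigma> *\<^sub>R unit_vec i + \<tau> *\<^sub>R unit_vec j | \<sigma> \<tau> i j.
        \<sigma> \<in> {1, -1} \<and> \<tau> \<in> {1, -1} \<and> 1 \<le> i \<and> i < j \<and> j \<le> 5} \<union>
     {(\<sigma> / 2) *\<^sub>R (unit_vec 8 - unit_vec 7 - unit_vec 6 + (\<Sum>i=1..5. (-1) ^ \<nu> i *\<^sub>R unit_vec i))
        | \<sigma> (\<nu> :: nat \<Rightarrow> nat).
        \<sigma> \<in> {1, -1} \<and> (\<forall>i\<in>{1..5}. \<nu> i \<in> {0, 1}) \<and> even (\<Sum>i=1..5. \<nu> i)}"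

definition root_a :: "real^8" ("\<a>") where
  "\<a> = (1/2) *\<^sub>R (unit_vec 1 + unit_vec 8 - unit_vec 2 - unit_vec 3 - unit_vec 4
                   - unit_vec 5 - unit_vec 6 - unit_vec 7)"
definition root_b :: "real^8" ("\<b>") where "\<b> = unit_vec 1 + unit_vec 2"
definition root_c :: "real^8" ("\<c>") where "\<c> = unit_vec 2 - unit_vec 1"
definition root_d :: "real^8" ("\<d>") where "\<d> = unit_vec 3 - unit_vec 2"
definition root_e :: "real^8" ("\<e>") where "\<e> = unit_vec 4 - unit_vec 3"
definition root_f :: "real^8" ("\<f>") where "\<f> = unit_vec 5 - unit_vec 4"

definition simple_roots :: "(real^8) set" where
  "simple_roots = {\<a>, \<b>, \<c>, \<d>, \<e>, \<f>}"

definition E6_space :: "(real^8) set" where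
  "E6_space = span simple_roots"

definition prec :: "real^8 \<Rightarrow> real^8 \<Rightarrow> bool" (infix "\<prec>" 50) where
  "x \<prec> y \<longleftrightarrow>
     (\<exists>\<tau> :: nat \<Rightarrow> real.
        y - x = \<tau> 1 *\<^sub>R \<f> + \<tau> 2 *\<^sub>R \<e> + \<tau> 3 *\<^sub>R \<b> + \<tau> 4 *\<^sub>R \<d> + \<tau> 5 *\<^sub>R \<c> + \<tau> 6 *\<^sub>R \<a> \<and>
        (\<exists>k\<in>{1..6}. (\<forall>j\<in>{1..<k}. \<tau> j = 0) \<and> \<tau> k > 0))"

definition special :: "real^8 \<Rightarrow> real^8 \<Rightarrow> bool" where
  "special r s \<longleftrightarrow> r \<in> E6 \<and> s \<in> E6 \<and> 0 \<prec> r \<and> r \<prec> s \<and> r + s \<in> E6"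

definition extraspecial :: "real^8 \<Rightarrow> real^8 \<Rightarrow> bool" where
  "extraspecial r s \<longleftrightarrow>
     special r s \<and> (\<forall>r1 s1. special r1 s1 \<and> r1 + s1 = r + s \<longrightarrow> r \<prec> r1 \<or> r = r1)"


section \<open>Complex Lie algebras\<close>

locale lie_algebra = vector_space scale
  for scale :: "complex \<Rightarrow> 'g::ab_group_add \<Rightarrow> 'g" +
  fixes br :: "'g \<Rightarrow> 'g \<Rightarrow> 'g"
  assumes br_add_left: "br (x + y) z = br x z + br y z"
    and br_add_right: "br x (y + z) = br x y + br x z"
    and br_scale_left: "br (scale c x) y = scale c (br x y)"
    and br_scale_right: "br x (scale c y) = scale c (br x y)"
    and br_self: "br x x = 0"
    and jacobi: "br x (br y z) + br y (br z x) + br z (br x y) = 0"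
begin

definition lie_ideal :: "'g set \<Rightarrow> bool" where
  "lie_ideal I \<longleftrightarrow> subspace I \<and> (\<forall>x. \<forall>y\<in>I. br x y \<in> I)"

definition subalgebra :: "'g set \<Rightarrow> bool" where
  "subalgebra H \<longleftrightarrow> subspace H \<and> (\<forall>x\<in>H. \<forall>y\<in>H. br x y \<in> H)"

definition bracket_span :: "'g set \<Rightarrow> 'g set \<Rightarrow> 'g set" where
  "bracket_span A B = span {br x y | x y. x \<in> A \<and> y \<in> B}"

text \<open>The iterates of \<open>bracket_span H\<close> at \<open>H\<close> form the lower central series.\<close>

definition nilpotent_subalgebra :: "'g set \<Rightarrow> bool" where
  "nilpotent_subalgebra H \<longleftrightarrow> subalgebra H \<and> (\<exists>n. (bracket_span H ^^ n) H = {0})"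

definition normalizer :: "'g set \<Rightarrow> 'g set" where
  "normalizer H = {x. \<forall>y\<in>H. br x y \<in> H}"

definition cartan_subalgebra :: "'g set \<Rightarrow> bool" where
  "cartan_subalgebra H \<longleftrightarrow> nilpotent_subalgebra H \<and> normalizer H = H"

text \<open>
  Linear functionals on a subspace \<open>H\<close> are represented by functions that are
  \<^const>\<open>undefined\<close> outside \<open>H\<close>, so that equality of functionals is HOL equality.
\<close>

definition functionals :: "'g set \<Rightarrow> ('g \<Rightarrow> complex) set" where
  "functionals H =
     {\<mu> \<in> extensional H. (\<forall>x\<in>H. \<forall>y\<in>H. \<mu> (x + y) = \<mu> x + \<mu> y) \<and>
                         (\<forall>c. \<forall>x\<in>H. \<mu> (scale c x) = c * \<mu> x)}"

definition root_space :: "'g set \<Rightarrow> ('g \<Rightarrow> complex) \<Rightarrow> 'g set" where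
  "root_space H \<mu> = {x. \<forall>y\<in>H. br y x = scale (\<mu> y) x}"

definition roots :: "'g set \<Rightarrow> ('g \<Rightarrow> complex) set" where
  "roots H = {\<mu> \<in> functionals H. (\<exists>y\<in>H. \<mu> y \<noteq> 0) \<and> root_space H \<mu> \<noteq> {0}}"

text \<open>
  The coroot of a root \<open>\<mu>\<close> is the unique element of \<open>H\<close> lying in \<open>[L\<^sub>\<mu>, L\<^sub>-\<^sub>\<mu>]\<close>
  on which \<open>\<mu>\<close> takes the value 2.
\<close>

definition is_coroot :: "'g set \<Rightarrow> ('g \<Rightarrow> complex) \<Rightarrow> 'g \<Rightarrow> bool" where
  "is_coroot H \<mu> t \<longleftrightarrow>
     t \<in> H \<and> t \<in> bracket_span (root_space H \<mu>) (root_space H (\<lambda>y. - \<mu> y)) \<and> \<mu> t = 2"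

text \<open>
  An isomorphism from \<^const>\<open>E6\<close> onto the root system of the algebra with respect to
  \<open>H\<close>: a real-linear map from the span of \<^const>\<open>E6\<close> to the dual of \<open>H\<close> that maps
  \<^const>\<open>E6\<close> bijectively onto the roots and preserves the Cartan integers.
  Its existence says that the algebra is of type \<open>E\<^sub>6\<close>.
\<close>

definition E6_root_iso :: "'g set \<Rightarrow> (real^8 \<Rightarrow> 'g \<Rightarrow> complex) \<Rightarrow> bool" where
  "E6_root_iso H \<phi> \<longleftrightarrow>
     (\<forall>x\<in>E6_space. \<forall>y\<in>E6_space. \<forall>t\<in>H. \<phi> (x + y) t = \<phi> x t + \<phi> y t) \<and>
     (\<forall>c. \<forall>x\<in>E6_space. \<forall>t\<in>H. \<phi> (c *\<^sub>R x) t = of_real c * \<phi> x t) \<and>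
     bij_betw \<phi> E6 (roots H) \<and>
     (\<forall>r\<in>E6. \<forall>s\<in>E6. \<forall>t. is_coroot H (\<phi> r) t \<longrightarrow>
        \<phi> s t = of_real (2 * (s \<bullet> r) / (r \<bullet> r)))"

text \<open>
  A Chevalley basis relative to \<open>H\<close> and the identification \<open>\<phi>\<close> of the roots with \<^const>\<open>E6\<close>;
  \<open>h r\<close> is the coroot and \<open>e r\<close> the root vector of \<open>r\<close>. In general
  \<open>[e r, e s] = \<plusminus>(p+1) e (r+s)\<close>, where \<open>p\<close> is the largest integer with \<open>s - p r\<close> a root;
  here all roots have the same length, so \<open>p = 0\<close> whenever \<open>r + s\<close> is a root. No two members of
  the basis coincide: root vectors of different roots lie in root spaces with zero intersection,
  as do root vectors and \<open>H\<close>, and different simple roots have different coroots.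
\<close>

definition chevalley_basis ::
  "'g set \<Rightarrow> (real^8 \<Rightarrow> 'g \<Rightarrow> complex) \<Rightarrow> (real^8 \<Rightarrow> 'g) \<Rightarrow> (real^8 \<Rightarrow> 'g) \<Rightarrow> bool" where
  "chevalley_basis H \<phi> h e \<longleftrightarrow>
     (\<forall>r\<in>E6. is_coroot H (\<phi> r) (h r)) \<and>
     (\<forall>r\<in>E6. e r \<in> root_space H (\<phi> r)) \<and>
     independent (h ` simple_roots \<union> e ` E6) \<and>
     span (h ` simple_roots \<union> e ` E6) = UNIV \<and>
     (\<forall>r\<in>E6. br (e r) (e (- r)) = h r) \<and>
     (\<forall>r\<in>E6. \<forall>s\<in>E6. r + s \<in> E6 \<longrightarrow>
        br (e r) (e s) = e (r + s) \<or> br (e r) (e s) = - e (r + s))"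

text \<open>
  Values of \<open>N\<close> are constrained only at pairs of roots \<open>r\<close>, \<open>s\<close> with \<open>r + s \<noteq> 0\<close>.
\<close>

definition structure_constants ::
  "(real^8 \<Rightarrow> 'g) \<Rightarrow> (real^8 \<Rightarrow> real^8 \<Rightarrow> int) \<Rightarrow> bool" where
  "structure_constants e N \<longleftrightarrow>
     (\<forall>r\<in>E6. \<forall>s\<in>E6.
        (r + s \<in> E6 \<longrightarrow> br (e r) (e s) = scale (of_int (N r s)) (e (r + s))) \<and>
        (r + s \<notin> E6 \<and> r + s \<noteq> 0 \<longrightarrow> N r s = 0))"

end

locale simple_lie_algebra = lie_algebra +
  assumes finite_dim: "\<exists>B. finite B \<and> span B = UNIV"
    and non_abelian: "\<exists>x y. br x y \<noteq> 0"
    and only_trivial_ideals: "lie_ideal I \<Longrightarrow> I = {0} \<or> I = UNIV"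


section \<open>Tables of structure constants\<close>

text \<open>An entry \<open>(r, s, v)\<close> of a table stands for \<open>N r s = v\<close>.\<close>

type_synonym table = "((real^8) \<times> (real^8) \<times> int) list"

definition table_pairs :: "table \<Rightarrow> ((real^8) \<times> (real^8)) set" where
  "table_pairs T = {(r, s). \<exists>v. (r, s, v) \<in> set T}"

definition table_holds :: "(real^8 \<Rightarrow> real^8 \<Rightarrow> int) \<Rightarrow> table \<Rightarrow> bool" where
  "table_holds N T \<longleftrightarrow> (\<forall>(r, s, v) \<in> set T. N r s = v)"

definition extraspecial_table ::
  "(nat \<Rightarrow> int) \<Rightarrow> (nat \<Rightarrow> int) \<Rightarrow> (nat \<Rightarrow> int) \<Rightarrow> (nat \<Rightarrow> int) \<Rightarrow> (nat \<Rightarrow> int) \<Rightarrow> table" where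
  "extraspecial_table \<alpha> \<beta> \<gamma> \<delta> \<epsilon> =
   [(\<a>, \<c>, \<alpha> 1),
    (\<a>, \<c> + \<d>, \<alpha> 2),
    (\<a>, \<b> + \<c> + \<d>, \<alpha> 3),
    (\<a>, \<c> + \<d> + \<e>, \<alpha> 4),
    (\<a>, \<b> + \<c> + \<d> + \<e>, \<alpha> 5),
    (\<a>, \<b> + \<c> + 2 *\<^sub>R \<d> + \<e>, \<alpha> 6),
    (\<a>, \<c> + \<d> + \<e> + \<f>, \<alpha> 7),
    (\<a>, \<b> + \<c> + \<d> + \<e> + \<f>, \<alpha> 8),
    (\<a>, \<b> + \<c> + 2 *\<^sub>R \<d> + \<e> + \<f>, \<alpha> 9),
    (\<a>, \<b> + \<c> + 2 *\<^sub>R \<d> + 2 *\<^sub>R \<e> + \<f>, \<alpha> 0),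
    (\<c>, \<d>, \<beta> 1),
    (\<c>, \<b> + \<d>, \<beta> 2),
    (\<c>, \<d> + \<e>, \<beta> 3),
    (\<c>, \<b> + \<d> + \<e>, \<beta> 4),
    (\<c>, \<a> + \<b> + \<c> + 2 *\<^sub>R \<d> + \<e>, \<beta> 5),
    (\<c>, \<d> + \<e> + \<f>, \<beta> 6),
    (\<c>, \<b> + \<d> + \<e> + \<f>, \<beta> 7),
    (\<c>, \<a> + \<b> + \<c> + 2 *\<^sub>R \<d> + \<e> + \<f>, \<beta> 8),
    (\<c>, \<a> + \<b> + \<c> + 2 *\<^sub>R \<d> + 2 *\<^sub>R \<e> + \<f>, \<beta> 9),
    (\<d>, \<b>, \<gamma> 1),
    (\<d>, \<e>, \<gamma> 2),
    (\<d>, \<b> + \<c> + \<d> + \<e>, \<gamma> 3),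
    (\<d>, \<e> + \<f>, \<gamma> 4),
    (\<d>, \<b> + \<c> + \<d> + \<e> + \<f>, \<gamma> 5),
    (\<d>, \<a> + \<b> + 2 *\<^sub>R \<c> + 2 *\<^sub>R \<d> + 2 *\<^sub>R \<e> + \<f>, \<gamma> 6),
    (\<b>, \<d> + \<e>, \<delta> 1),
    (\<b>, \<d> + \<e> + \<f>, \<delta> 2),
    (\<b>, \<a> + \<b> + 2 *\<^sub>R \<c> + 3 *\<^sub>R \<d> + 2 *\<^sub>R \<e> + \<f>, \<delta> 3),
    (\<e>, \<f>, \<epsilon> 1),
    (\<e>, \<b> + \<c> + 2 *\<^sub>R \<d> + \<e> + \<f>, \<epsilon> 2)]"

definition further_table ::
  "(nat \<Rightarrow> int) \<Rightarrow> (nat \<Rightarrow> int) \<Rightarrow> (nat \<Rightarrow> int) \<Rightarrow> (nat \<Rightarrow> int) \<Rightarrow> (nat \<Rightarrow> int) \<Rightarrow> table" where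
  "further_table \<alpha> \<beta> \<gamma> \<delta> \<epsilon> =
   [(\<a> + \<c>, \<d>, \<alpha> 1 * \<alpha> 2 * \<beta> 1),
    (\<a> + \<c>, \<b> + \<d>, \<alpha> 1 * \<alpha> 3 * \<beta> 2),
    (\<a> + \<c>, \<d> + \<e>, \<alpha> 1 * \<alpha> 4 * \<beta> 3),
    (\<a> + \<c>, \<b> + \<d> + \<e>, \<alpha> 1 * \<alpha> 5 * \<beta> 4),
    (\<a> + \<c>, \<b> + \<c> + 2 *\<^sub>R \<d> + \<e>, - (\<alpha> 1 * \<alpha> 6 * \<beta> 5)),
    (\<a> + \<c>, \<d> + \<e> + \<f>, \<alpha> 1 * \<alpha> 7 * \<beta> 6),
    (\<a> + \<c>, \<b> + \<d> + \<e> + \<f>, \<alpha> 1 * \<alpha> 8 * \<beta> 7),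
    (\<a> + \<c>, \<b> + \<c> + 2 *\<^sub>R \<d> + \<e> + \<f>, - (\<alpha> 1 * \<alpha> 9 * \<beta> 8)),
    (\<a> + \<c>, \<b> + \<c> + 2 *\<^sub>R \<d> + 2 *\<^sub>R \<e> + \<f>, - (\<alpha> 1 * \<alpha> 0 * \<beta> 9)),
    (\<d>, \<a> + \<b> + \<c> + \<d> + \<e>, \<alpha> 5 * \<alpha> 6 * \<gamma> 3),
    (\<d>, \<a> + \<b> + \<c> + \<d> + \<e> + \<f>, \<alpha> 8 * \<alpha> 9 * \<gamma> 5),
    (\<c> + \<d>, \<b>, \<beta> 1 * \<beta> 2 * \<gamma> 1),
    (\<c> + \<d>, \<e>, \<beta> 1 * \<beta> 3 * \<gamma> 2),
    (\<c> + \<d>, \<b> + \<d> + \<e>, - (\<beta> 1 * \<beta> 4 * \<gamma> 3)),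
    (\<c> + \<d>, \<a> + \<b> + \<c> + \<d> + \<e>, \<alpha> 5 * \<alpha> 6 * \<beta> 1 * \<beta> 5 * \<gamma> 3),
    (\<c> + \<d>, \<e> + \<f>, \<beta> 1 * \<beta> 6 * \<gamma> 4),
    (\<c> + \<d>, \<b> + \<d> + \<e> + \<f>, - (\<beta> 1 * \<beta> 7 * \<gamma> 5)),
    (\<c> + \<d>, \<a> + \<b> + \<c> + \<d> + \<e> + \<f>, \<alpha> 8 * \<alpha> 9 * \<beta> 1 * \<beta> 8 * \<gamma> 5),
    (\<c> + \<d>, \<a> + \<b> + \<c> + 2 *\<^sub>R \<d> + 2 *\<^sub>R \<e> + \<f>, - (\<beta> 1 * \<beta> 9 * \<gamma> 6)),
    (\<a> + \<c> + \<d>, \<b>, \<alpha> 2 * \<alpha> 3 * \<beta> 1 * \<beta> 2 * \<gamma> 1),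
    (\<a> + \<c> + \<d>, \<e>, \<alpha> 2 * \<alpha> 4 * \<beta> 1 * \<beta> 3 * \<gamma> 2),
    (\<a> + \<c> + \<d>, \<b> + \<d> + \<e>, - (\<alpha> 2 * \<alpha> 6 * \<beta> 1 * \<beta> 4 * \<gamma> 3)),
    (\<a> + \<c> + \<d>, \<b> + \<c> + \<d> + \<e>, - (\<alpha> 2 * \<alpha> 6 * \<beta> 1 * \<beta> 5 * \<gamma> 3)),
    (\<a> + \<c> + \<d>, \<e> + \<f>, \<alpha> 2 * \<alpha> 7 * \<beta> 1 * \<beta> 6 * \<gamma> 4),
    (\<a> + \<c> + \<d>, \<b> + \<d> + \<e> + \<f>, - (\<alpha> 2 * \<alpha> 9 * \<beta> 1 * \<beta> 7 * \<gamma> 5)),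
    (\<a> + \<c> + \<d>, \<b> + \<c> + \<d> + \<e> + \<f>, - (\<alpha> 2 * \<alpha> 9 * \<beta> 1 * \<beta> 8 * \<gamma> 5)),
    (\<a> + \<c> + \<d>, \<b> + \<c> + 2 *\<^sub>R \<d> + 2 *\<^sub>R \<e> + \<f>, \<alpha> 2 * \<alpha> 0 * \<beta> 1 * \<beta> 9 * \<gamma> 6),
    (\<b>, \<c> + \<d> + \<e>, \<beta> 3 * \<beta> 4 * \<delta> 1),
    (\<b>, \<a> + \<c> + \<d> + \<e>, \<alpha> 4 * \<alpha> 5 * \<beta> 3 * \<beta> 4 * \<delta> 1),
    (\<b>, \<c> + \<d> + \<e> + \<f>, \<beta> 6 * \<beta> 7 * \<delta> 2),
    (\<b>, \<a> + \<c> + \<d> + \<e> + \<f>, \<alpha> 7 * \<alpha> 8 * \<beta> 6 * \<beta> 7 * \<delta> 2),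
    (\<b> + \<d>, \<e>, - (\<gamma> 1 * \<gamma> 2 * \<delta> 1)),
    (\<b> + \<d>, \<c> + \<d> + \<e>, \<beta> 3 * \<beta> 4 * \<gamma> 1 * \<gamma> 3 * \<delta> 1),
    (\<b> + \<d>, \<a> + \<c> + \<d> + \<e>, \<alpha> 4 * \<alpha> 6 * \<beta> 3 * \<beta> 4 * \<gamma> 1 * \<gamma> 3 * \<delta> 1),
    (\<b> + \<d>, \<e> + \<f>, - (\<gamma> 1 * \<gamma> 4 * \<delta> 2)),
    (\<b> + \<d>, \<c> + \<d> + \<e> + \<f>, \<beta> 6 * \<beta> 7 * \<gamma> 1 * \<gamma> 5 * \<delta> 2),
    (\<b> + \<d>, \<a> + \<c> + \<d> + \<e> + \<f>, \<alpha> 7 * \<alpha> 9 * \<beta> 6 * \<beta> 7 * \<gamma> 1 * \<gamma> 5 * \<delta> 2),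
    (\<b> + \<d>, \<a> + \<b> + 2 *\<^sub>R \<c> + 2 *\<^sub>R \<d> + 2 *\<^sub>R \<e> + \<f>, - (\<gamma> 1 * \<gamma> 6 * \<delta> 3)),
    (\<b> + \<c> + \<d>, \<e>, - (\<beta> 2 * \<beta> 4 * \<gamma> 1 * \<gamma> 2 * \<delta> 1)),
    (\<b> + \<c> + \<d>, \<d> + \<e>, - (\<beta> 2 * \<beta> 4 * \<gamma> 1 * \<gamma> 3 * \<delta> 1)),
    (\<b> + \<c> + \<d>, \<a> + \<c> + \<d> + \<e>, \<alpha> 4 * \<alpha> 6 * \<beta> 2 * \<beta> 3 * \<beta> 4 * \<beta> 5 * \<gamma> 1 * \<gamma> 3 * \<delta> 1),
    (\<b> + \<c> + \<d>, \<e> + \<f>, - (\<beta> 2 * \<beta> 7 * \<gamma> 1 * \<gamma> 4 * \<delta> 2)),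
    (\<b> + \<c> + \<d>, \<d> + \<e> + \<f>, - (\<beta> 2 * \<beta> 7 * \<gamma> 1 * \<gamma> 5 * \<delta> 2)),
    (\<b> + \<c> + \<d>, \<a> + \<c> + \<d> + \<e> + \<f>, \<alpha> 7 * \<alpha> 9 * \<beta> 2 * \<beta> 6 * \<beta> 7 * \<beta> 8 * \<gamma> 1 * \<gamma> 5 * \<delta> 2),
    (\<b> + \<c> + \<d>, \<a> + \<b> + \<c> + 2 *\<^sub>R \<d> + 2 *\<^sub>R \<e> + \<f>, \<beta> 2 * \<beta> 9 * \<gamma> 1 * \<gamma> 6 * \<delta> 3),
    (\<a> + \<b> + \<c> + \<d>, \<e>, - (\<alpha> 3 * \<alpha> 5 * \<beta> 2 * \<beta> 4 * \<gamma> 1 * \<gamma> 2 * \<delta> 1)),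
    (\<a> + \<b> + \<c> + \<d>, \<d> + \<e>, - (\<alpha> 3 * \<alpha> 6 * \<beta> 2 * \<beta> 4 * \<gamma> 1 * \<gamma> 3 * \<delta> 1)),
    (\<a> + \<b> + \<c> + \<d>, \<c> + \<d> + \<e>, - (\<alpha> 3 * \<alpha> 6 * \<beta> 2 * \<beta> 3 * \<beta> 4 * \<beta> 5 * \<gamma> 1 * \<gamma> 3 * \<delta> 1)),
    (\<a> + \<b> + \<c> + \<d>, \<e> + \<f>, - (\<alpha> 3 * \<alpha> 8 * \<beta> 2 * \<beta> 7 * \<gamma> 1 * \<gamma> 4 * \<delta> 2)),
    (\<a> + \<b> + \<c> + \<d>, \<d> + \<e> + \<f>, - (\<alpha> 3 * \<alpha> 9 * \<beta> 2 * \<beta> 7 * \<gamma> 1 * \<gamma> 5 * \<delta> 2)),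
    (\<a> + \<b> + \<c> + \<d>, \<c> + \<d> + \<e> + \<f>, - (\<alpha> 3 * \<alpha> 9 * \<beta> 2 * \<beta> 6 * \<beta> 7 * \<beta> 8 * \<gamma> 1 * \<gamma> 5 * \<delta> 2)),
    (\<a> + \<b> + \<c> + \<d>, \<b> + \<c> + 2 *\<^sub>R \<d> + 2 *\<^sub>R \<e> + \<f>, - (\<alpha> 3 * \<alpha> 0 * \<beta> 2 * \<beta> 9 * \<gamma> 1 * \<gamma> 6 * \<delta> 3)),
    (\<e>, \<a> + \<b> + \<c> + 2 *\<^sub>R \<d> + \<e> + \<f>, \<alpha> 9 * \<alpha> 0 * \<epsilon> 2),
    (\<e>, \<a> + \<b> + 2 *\<^sub>R \<c> + 2 *\<^sub>R \<d> + \<e> + \<f>, \<alpha> 9 * \<alpha> 0 * \<beta> 8 * \<beta> 9 * \<epsilon> 2),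
    (\<d> + \<e>, \<f>, \<gamma> 2 * \<gamma> 4 * \<epsilon> 1),
    (\<d> + \<e>, \<b> + \<c> + \<d> + \<e> + \<f>, - (\<gamma> 2 * \<gamma> 5 * \<epsilon> 2)),
    (\<d> + \<e>, \<a> + \<b> + \<c> + \<d> + \<e> + \<f>, - (\<alpha> 8 * \<alpha> 0 * \<gamma> 2 * \<gamma> 5 * \<epsilon> 2)),
    (\<d> + \<e>, \<a> + \<b> + 2 *\<^sub>R \<c> + 2 *\<^sub>R \<d> + \<e> + \<f>, \<alpha> 9 * \<alpha> 0 * \<beta> 8 * \<beta> 9 * \<gamma> 2 * \<gamma> 6 * \<epsilon> 2),
    (\<c> + \<d> + \<e>, \<f>, \<beta> 3 * \<beta> 6 * \<gamma> 2 * \<gamma> 4 * \<epsilon> 1),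
    (\<c> + \<d> + \<e>, \<b> + \<d> + \<e> + \<f>, \<beta> 3 * \<beta> 7 * \<gamma> 2 * \<gamma> 5 * \<epsilon> 2),
    (\<c> + \<d> + \<e>, \<a> + \<b> + \<c> + \<d> + \<e> + \<f>, - (\<alpha> 8 * \<alpha> 0 * \<beta> 3 * \<beta> 9 * \<gamma> 2 * \<gamma> 5 * \<epsilon> 2)),
    (\<c> + \<d> + \<e>, \<a> + \<b> + \<c> + 2 *\<^sub>R \<d> + \<e> + \<f>, - (\<alpha> 9 * \<alpha> 0 * \<beta> 3 * \<beta> 9 * \<gamma> 2 * \<gamma> 6 * \<epsilon> 2)),
    (\<a> + \<c> + \<d> + \<e>, \<f>, \<alpha> 4 * \<alpha> 7 * \<beta> 3 * \<beta> 6 * \<gamma> 2 * \<gamma> 4 * \<epsilon> 1),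
    (\<a> + \<c> + \<d> + \<e>, \<b> + \<d> + \<e> + \<f>, \<alpha> 4 * \<alpha> 0 * \<beta> 3 * \<beta> 7 * \<gamma> 2 * \<gamma> 5 * \<epsilon> 2),
    (\<a> + \<c> + \<d> + \<e>, \<b> + \<c> + \<d> + \<e> + \<f>, \<alpha> 4 * \<alpha> 0 * \<beta> 3 * \<beta> 9 * \<gamma> 2 * \<gamma> 5 * \<epsilon> 2),
    (\<a> + \<c> + \<d> + \<e>, \<b> + \<c> + 2 *\<^sub>R \<d> + \<e> + \<f>, \<alpha> 4 * \<alpha> 0 * \<beta> 3 * \<beta> 9 * \<gamma> 2 * \<gamma> 6 * \<epsilon> 2),
    (\<b> + \<d> + \<e>, \<f>, \<gamma> 2 * \<gamma> 4 * \<delta> 1 * \<delta> 2 * \<epsilon> 1),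
    (\<b> + \<d> + \<e>, \<c> + \<d> + \<e> + \<f>, \<beta> 6 * \<beta> 7 * \<gamma> 2 * \<gamma> 5 * \<delta> 1 * \<delta> 2 * \<epsilon> 2),
    (\<b> + \<d> + \<e>, \<a> + \<c> + \<d> + \<e> + \<f>, \<alpha> 7 * \<alpha> 0 * \<beta> 6 * \<beta> 7 * \<gamma> 2 * \<gamma> 5 * \<delta> 1 * \<delta> 2 * \<epsilon> 2),
    (\<b> + \<d> + \<e>, \<a> + \<b> + 2 *\<^sub>R \<c> + 2 *\<^sub>R \<d> + \<e> + \<f>, \<alpha> 9 * \<alpha> 0 * \<beta> 8 * \<beta> 9 * \<gamma> 2 * \<gamma> 6 * \<delta> 1 * \<delta> 3 * \<epsilon> 2),
    (\<b> + \<c> + \<d> + \<e>, \<f>, \<beta> 4 * \<beta> 7 * \<gamma> 2 * \<gamma> 4 * \<delta> 1 * \<delta> 2 * \<epsilon> 1),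
    (\<b> + \<c> + \<d> + \<e>, \<d> + \<e> + \<f>, - (\<beta> 4 * \<beta> 7 * \<gamma> 2 * \<gamma> 5 * \<delta> 1 * \<delta> 2 * \<epsilon> 2)),
    (\<b> + \<c> + \<d> + \<e>, \<a> + \<c> + \<d> + \<e> + \<f>, \<alpha> 7 * \<alpha> 0 * \<beta> 4 * \<beta> 6 * \<beta> 7 * \<beta> 9 * \<gamma> 2 * \<gamma> 5 * \<delta> 1 * \<delta> 2 * \<epsilon> 2),
    (\<b> + \<c> + \<d> + \<e>, \<a> + \<b> + \<c> + 2 *\<^sub>R \<d> + \<e> + \<f>, - (\<alpha> 9 * \<alpha> 0 * \<beta> 4 * \<beta> 9 * \<gamma> 2 * \<gamma> 6 * \<delta> 1 * \<delta> 3 * \<epsilon> 2)),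
    (\<a> + \<b> + \<c> + \<d> + \<e>, \<f>, \<alpha> 5 * \<alpha> 8 * \<beta> 4 * \<beta> 7 * \<gamma> 2 * \<gamma> 4 * \<delta> 1 * \<delta> 2 * \<epsilon> 1),
    (\<a> + \<b> + \<c> + \<d> + \<e>, \<d> + \<e> + \<f>, - (\<alpha> 5 * \<alpha> 0 * \<beta> 4 * \<beta> 7 * \<gamma> 2 * \<gamma> 5 * \<delta> 1 * \<delta> 2 * \<epsilon> 2)),
    (\<a> + \<b> + \<c> + \<d> + \<e>, \<c> + \<d> + \<e> + \<f>, - (\<alpha> 5 * \<alpha> 0 * \<beta> 4 * \<beta> 6 * \<beta> 7 * \<beta> 9 * \<gamma> 2 * \<gamma> 5 * \<delta> 1 * \<delta> 2 * \<epsilon> 2)),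
    (\<a> + \<b> + \<c> + \<d> + \<e>, \<b> + \<c> + 2 *\<^sub>R \<d> + \<e> + \<f>, \<alpha> 5 * \<alpha> 0 * \<beta> 4 * \<beta> 9 * \<gamma> 2 * \<gamma> 6 * \<delta> 1 * \<delta> 3 * \<epsilon> 2),
    (\<b> + \<c> + 2 *\<^sub>R \<d> + \<e>, \<f>, \<beta> 4 * \<beta> 7 * \<gamma> 2 * \<gamma> 3 * \<gamma> 4 * \<gamma> 5 * \<delta> 1 * \<delta> 2 * \<epsilon> 1),
    (\<b> + \<c> + 2 *\<^sub>R \<d> + \<e>, \<e> + \<f>, \<beta> 4 * \<beta> 7 * \<gamma> 2 * \<gamma> 3 * \<gamma> 4 * \<gamma> 5 * \<delta> 1 * \<delta> 2 * \<epsilon> 2),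
    (\<b> + \<c> + 2 *\<^sub>R \<d> + \<e>, \<a> + \<c> + \<d> + \<e> + \<f>, \<alpha> 7 * \<alpha> 0 * \<beta> 4 * \<beta> 6 * \<beta> 7 * \<beta> 9 * \<gamma> 2 * \<gamma> 3 * \<gamma> 5 * \<gamma> 6 * \<delta> 1 * \<delta> 2 * \<epsilon> 2),
    (\<b> + \<c> + 2 *\<^sub>R \<d> + \<e>, \<a> + \<b> + \<c> + \<d> + \<e> + \<f>, \<alpha> 8 * \<alpha> 0 * \<beta> 4 * \<beta> 9 * \<gamma> 2 * \<gamma> 3 * \<gamma> 5 * \<gamma> 6 * \<delta> 1 * \<delta> 3 * \<epsilon> 2),
    (\<a> + \<b> + \<c> + 2 *\<^sub>R \<d> + \<e>, \<f>, \<alpha> 6 * \<alpha> 9 * \<beta> 4 * \<beta> 7 * \<gamma> 2 * \<gamma> 3 * \<gamma> 4 * \<gamma> 5 * \<delta> 1 * \<delta> 2 * \<epsilon> 1),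
    (\<a> + \<b> + \<c> + 2 *\<^sub>R \<d> + \<e>, \<e> + \<f>, \<alpha> 6 * \<alpha> 0 * \<beta> 4 * \<beta> 7 * \<gamma> 2 * \<gamma> 3 * \<gamma> 4 * \<gamma> 5 * \<delta> 1 * \<delta> 2 * \<epsilon> 2),
    (\<a> + \<b> + \<c> + 2 *\<^sub>R \<d> + \<e>, \<c> + \<d> + \<e> + \<f>, - (\<alpha> 6 * \<alpha> 0 * \<beta> 4 * \<beta> 6 * \<beta> 7 * \<beta> 9 * \<gamma> 2 * \<gamma> 3 * \<gamma> 5 * \<gamma> 6 * \<delta> 1 * \<delta> 2 * \<epsilon> 2)),
    (\<a> + \<b> + \<c> + 2 *\<^sub>R \<d> + \<e>, \<b> + \<c> + \<d> + \<e> + \<f>, - (\<alpha> 6 * \<alpha> 0 * \<beta> 4 * \<beta> 9 * \<gamma> 2 * \<gamma> 3 * \<gamma> 5 * \<gamma> 6 * \<delta> 1 * \<delta> 3 * \<epsilon> 2)),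
    (\<a> + \<b> + 2 *\<^sub>R \<c> + 2 *\<^sub>R \<d> + \<e>, \<f>, \<alpha> 6 * \<alpha> 9 * \<beta> 4 * \<beta> 5 * \<beta> 7 * \<beta> 8 * \<gamma> 2 * \<gamma> 3 * \<gamma> 4 * \<gamma> 5 * \<delta> 1 * \<delta> 2 * \<epsilon> 1),
    (\<a> + \<b> + 2 *\<^sub>R \<c> + 2 *\<^sub>R \<d> + \<e>, \<e> + \<f>, \<alpha> 6 * \<alpha> 0 * \<beta> 4 * \<beta> 5 * \<beta> 7 * \<beta> 9 * \<gamma> 2 * \<gamma> 3 * \<gamma> 4 * \<gamma> 5 * \<delta> 1 * \<delta> 2 * \<epsilon> 2),
    (\<a> + \<b> + 2 *\<^sub>R \<c> + 2 *\<^sub>R \<d> + \<e>, \<d> + \<e> + \<f>, \<alpha> 6 * \<alpha> 0 * \<beta> 4 * \<beta> 5 * \<beta> 7 * \<beta> 9 * \<gamma> 2 * \<gamma> 3 * \<gamma> 5 * \<gamma> 6 * \<delta> 1 * \<delta> 2 * \<epsilon> 2),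
    (\<a> + \<b> + 2 *\<^sub>R \<c> + 2 *\<^sub>R \<d> + \<e>, \<b> + \<d> + \<e> + \<f>, \<alpha> 6 * \<alpha> 0 * \<beta> 4 * \<beta> 5 * \<beta> 7 * \<beta> 9 * \<gamma> 2 * \<gamma> 3 * \<gamma> 5 * \<gamma> 6 * \<delta> 1 * \<delta> 3 * \<epsilon> 2)]"

end

theory Submission
  imports Defs
begin

text \<open>
  For roots \<open>x\<close>, \<open>y\<close>, \<open>z\<close> such that \<open>x + z\<close> is neither a root nor 0, the Jacobi identity reads
  \<open>N\<^bsub>x,y+z\<^esub> N\<^bsub>y,z\<^esub> = N\<^bsub>x,y\<^esub> N\<^bsub>x+y,z\<^esub>\<close>. The signs \<open>(-1)\<close> to the power of a bilinear form \<open>B\<close> with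
  \<open>B(u,v) + B(v,u) = (u,v)\<close> satisfy the same identity and the same antisymmetry, so the quotient of
  the two is a symmetric cocycle. By induction on the height of \<open>u + v\<close>, comparing a special pair with
  the extraspecial pair of the same sum, it is the coboundary of a sign function \<open>k\<close> on the positive
  roots, i.e. \<open>N\<^bsub>u,v\<^esub> = (-1)\<^bsup>B(u,v)\<^esup> k(u) k(v) k(u+v)\<close>, where \<open>k\<close> is fixed by the extraspecial pairs.
  The table is then read off. The constants with a negative index follow from
  \<open>N\<^bsub>r,s\<^esub> = N\<^bsub>s,t\<^esub> = N\<^bsub>t,r\<^esub>\<close> for \<open>r + s + t = 0\<close>, which is the Jacobi identity for \<open>e\<^sub>r\<close>, \<open>e\<^sub>s\<close>, \<open>e\<^sub>t\<close>.
\<close>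

section \<open>Roots as coefficient vectors\<close>

text \<open>Coefficients with respect to \<open>\<a>, \<b>, \<c>, \<d>, \<e>, \<f>\<close>, in this order.\<close>

type_synonym coeffs = "int \<times> int \<times> int \<times> int \<times> int \<times> int"

fun comb :: "coeffs \<Rightarrow> real^8" where
  "comb (a, b, c, d, e, f) =
     of_int a *\<^sub>R \<a> + of_int b *\<^sub>R \<b> + of_int c *\<^sub>R \<c> +
     of_int d *\<^sub>R \<d> + of_int e *\<^sub>R \<e> + of_int f *\<^sub>R \<f>"

fun lex_pos :: "coeffs \<Rightarrow> bool" where
  "lex_pos (a, b, c, d, e, f) \<longleftrightarrow>
     f > 0 \<or> f = 0 \<and> (e > 0 \<or> e = 0 \<and> (b > 0 \<or> b = 0 \<and>
       (d > 0 \<or> d = 0 \<and> (c > 0 \<or> c = 0 \<and> a > 0))))"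

text \<open>The simple roots, then the sums of the extraspecial pairs in the order of \<^const>\<open>extraspecial_table\<close>.\<close>

definition pos_roots :: "coeffs list" where
  "pos_roots =
  [(1, 0, 0, 0, 0, 0), (0, 1, 0, 0, 0, 0), (0, 0, 1, 0, 0, 0),
   (0, 0, 0, 1, 0, 0), (0, 0, 0, 0, 1, 0), (0, 0, 0, 0, 0, 1),
   (1, 0, 1, 0, 0, 0), (1, 0, 1, 1, 0, 0), (1, 1, 1, 1, 0, 0),
   (1, 0, 1, 1, 1, 0), (1, 1, 1, 1, 1, 0), (1, 1, 1, 2, 1, 0),
   (1, 0, 1, 1, 1, 1), (1, 1, 1, 1, 1, 1), (1, 1, 1, 2, 1, 1),
   (1, 1, 1, 2, 2, 1), (0, 0, 1, 1, 0, 0), (0, 1, 1, 1, 0, 0),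
   (0, 0, 1, 1, 1, 0), (0, 1, 1, 1, 1, 0), (1, 1, 2, 2, 1, 0),
   (0, 0, 1, 1, 1, 1), (0, 1, 1, 1, 1, 1), (1, 1, 2, 2, 1, 1),
   (1, 1, 2, 2, 2, 1), (0, 1, 0, 1, 0, 0), (0, 0, 0, 1, 1, 0),
   (0, 1, 1, 2, 1, 0), (0, 0, 0, 1, 1, 1), (0, 1, 1, 2, 1, 1),
   (1, 1, 2, 3, 2, 1), (0, 1, 0, 1, 1, 0), (0, 1, 0, 1, 1, 1),
   (1, 2, 2, 3, 2, 1), (0, 0, 0, 0, 1, 1), (0, 1, 1, 2, 2, 1)]"

definition root_list :: "coeffs list" where
  "root_list = pos_roots @ map uminus pos_roots"

text \<open>In the order of \<^const>\<open>extraspecial_table\<close> followed by \<^const>\<open>further_table\<close>.\<close>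

definition special_pairs :: "(coeffs \<times> coeffs) list" where
  "special_pairs =
  [((1, 0, 0, 0, 0, 0), (0, 0, 1, 0, 0, 0)), ((1, 0, 0, 0, 0, 0), (0, 0, 1, 1, 0, 0)),
   ((1, 0, 0, 0, 0, 0), (0, 1, 1, 1, 0, 0)), ((1, 0, 0, 0, 0, 0), (0, 0, 1, 1, 1, 0)),
   ((1, 0, 0, 0, 0, 0), (0, 1, 1, 1, 1, 0)), ((1, 0, 0, 0, 0, 0), (0, 1, 1, 2, 1, 0)),
   ((1, 0, 0, 0, 0, 0), (0, 0, 1, 1, 1, 1)), ((1, 0, 0, 0, 0, 0), (0, 1, 1, 1, 1, 1)),
   ((1, 0, 0, 0, 0, 0), (0, 1, 1, 2, 1, 1)), ((1, 0, 0, 0, 0, 0), (0, 1, 1, 2, 2, 1)),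
   ((0, 0, 1, 0, 0, 0), (0, 0, 0, 1, 0, 0)), ((0, 0, 1, 0, 0, 0), (0, 1, 0, 1, 0, 0)),
   ((0, 0, 1, 0, 0, 0), (0, 0, 0, 1, 1, 0)), ((0, 0, 1, 0, 0, 0), (0, 1, 0, 1, 1, 0)),
   ((0, 0, 1, 0, 0, 0), (1, 1, 1, 2, 1, 0)), ((0, 0, 1, 0, 0, 0), (0, 0, 0, 1, 1, 1)),
   ((0, 0, 1, 0, 0, 0), (0, 1, 0, 1, 1, 1)), ((0, 0, 1, 0, 0, 0), (1, 1, 1, 2, 1, 1)),
   ((0, 0, 1, 0, 0, 0), (1, 1, 1, 2, 2, 1)), ((0, 0, 0, 1, 0, 0), (0, 1, 0, 0, 0, 0)),
   ((0, 0, 0, 1, 0, 0), (0, 0, 0, 0, 1, 0)), ((0, 0, 0, 1, 0, 0), (0, 1, 1, 1, 1, 0)),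
   ((0, 0, 0, 1, 0, 0), (0, 0, 0, 0, 1, 1)), ((0, 0, 0, 1, 0, 0), (0, 1, 1, 1, 1, 1)),
   ((0, 0, 0, 1, 0, 0), (1, 1, 2, 2, 2, 1)), ((0, 1, 0, 0, 0, 0), (0, 0, 0, 1, 1, 0)),
   ((0, 1, 0, 0, 0, 0), (0, 0, 0, 1, 1, 1)), ((0, 1, 0, 0, 0, 0), (1, 1, 2, 3, 2, 1)),
   ((0, 0, 0, 0, 1, 0), (0, 0, 0, 0, 0, 1)), ((0, 0, 0, 0, 1, 0), (0, 1, 1, 2, 1, 1)),
   ((1, 0, 1, 0, 0, 0), (0, 0, 0, 1, 0, 0)), ((1, 0, 1, 0, 0, 0), (0, 1, 0, 1, 0, 0)),
   ((1, 0, 1, 0, 0, 0), (0, 0, 0, 1, 1, 0)), ((1, 0, 1, 0, 0, 0), (0, 1, 0, 1, 1, 0)),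
   ((1, 0, 1, 0, 0, 0), (0, 1, 1, 2, 1, 0)), ((1, 0, 1, 0, 0, 0), (0, 0, 0, 1, 1, 1)),
   ((1, 0, 1, 0, 0, 0), (0, 1, 0, 1, 1, 1)), ((1, 0, 1, 0, 0, 0), (0, 1, 1, 2, 1, 1)),
   ((1, 0, 1, 0, 0, 0), (0, 1, 1, 2, 2, 1)), ((0, 0, 0, 1, 0, 0), (1, 1, 1, 1, 1, 0)),
   ((0, 0, 0, 1, 0, 0), (1, 1, 1, 1, 1, 1)), ((0, 0, 1, 1, 0, 0), (0, 1, 0, 0, 0, 0)),
   ((0, 0, 1, 1, 0, 0), (0, 0, 0, 0, 1, 0)), ((0, 0, 1, 1, 0, 0), (0, 1, 0, 1, 1, 0)),
   ((0, 0, 1, 1, 0, 0), (1, 1, 1, 1, 1, 0)), ((0, 0, 1, 1, 0, 0), (0, 0, 0, 0, 1, 1)),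
   ((0, 0, 1, 1, 0, 0), (0, 1, 0, 1, 1, 1)), ((0, 0, 1, 1, 0, 0), (1, 1, 1, 1, 1, 1)),
   ((0, 0, 1, 1, 0, 0), (1, 1, 1, 2, 2, 1)), ((1, 0, 1, 1, 0, 0), (0, 1, 0, 0, 0, 0)),
   ((1, 0, 1, 1, 0, 0), (0, 0, 0, 0, 1, 0)), ((1, 0, 1, 1, 0, 0), (0, 1, 0, 1, 1, 0)),
   ((1, 0, 1, 1, 0, 0), (0, 1, 1, 1, 1, 0)), ((1, 0, 1, 1, 0, 0), (0, 0, 0, 0, 1, 1)),
   ((1, 0, 1, 1, 0, 0), (0, 1, 0, 1, 1, 1)), ((1, 0, 1, 1, 0, 0), (0, 1, 1, 1, 1, 1)),
   ((1, 0, 1, 1, 0, 0), (0, 1, 1, 2, 2, 1)), ((0, 1, 0, 0, 0, 0), (0, 0, 1, 1, 1, 0)),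
   ((0, 1, 0, 0, 0, 0), (1, 0, 1, 1, 1, 0)), ((0, 1, 0, 0, 0, 0), (0, 0, 1, 1, 1, 1)),
   ((0, 1, 0, 0, 0, 0), (1, 0, 1, 1, 1, 1)), ((0, 1, 0, 1, 0, 0), (0, 0, 0, 0, 1, 0)),
   ((0, 1, 0, 1, 0, 0), (0, 0, 1, 1, 1, 0)), ((0, 1, 0, 1, 0, 0), (1, 0, 1, 1, 1, 0)),
   ((0, 1, 0, 1, 0, 0), (0, 0, 0, 0, 1, 1)), ((0, 1, 0, 1, 0, 0), (0, 0, 1, 1, 1, 1)),
   ((0, 1, 0, 1, 0, 0), (1, 0, 1, 1, 1, 1)), ((0, 1, 0, 1, 0, 0), (1, 1, 2, 2, 2, 1)),
   ((0, 1, 1, 1, 0, 0), (0, 0, 0, 0, 1, 0)), ((0, 1, 1, 1, 0, 0), (0, 0, 0, 1, 1, 0)),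
   ((0, 1, 1, 1, 0, 0), (1, 0, 1, 1, 1, 0)), ((0, 1, 1, 1, 0, 0), (0, 0, 0, 0, 1, 1)),
   ((0, 1, 1, 1, 0, 0), (0, 0, 0, 1, 1, 1)), ((0, 1, 1, 1, 0, 0), (1, 0, 1, 1, 1, 1)),
   ((0, 1, 1, 1, 0, 0), (1, 1, 1, 2, 2, 1)), ((1, 1, 1, 1, 0, 0), (0, 0, 0, 0, 1, 0)),
   ((1, 1, 1, 1, 0, 0), (0, 0, 0, 1, 1, 0)), ((1, 1, 1, 1, 0, 0), (0, 0, 1, 1, 1, 0)),
   ((1, 1, 1, 1, 0, 0), (0, 0, 0, 0, 1, 1)), ((1, 1, 1, 1, 0, 0), (0, 0, 0, 1, 1, 1)),
   ((1, 1, 1, 1, 0, 0), (0, 0, 1, 1, 1, 1)), ((1, 1, 1, 1, 0, 0), (0, 1, 1, 2, 2, 1)),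
   ((0, 0, 0, 0, 1, 0), (1, 1, 1, 2, 1, 1)), ((0, 0, 0, 0, 1, 0), (1, 1, 2, 2, 1, 1)),
   ((0, 0, 0, 1, 1, 0), (0, 0, 0, 0, 0, 1)), ((0, 0, 0, 1, 1, 0), (0, 1, 1, 1, 1, 1)),
   ((0, 0, 0, 1, 1, 0), (1, 1, 1, 1, 1, 1)), ((0, 0, 0, 1, 1, 0), (1, 1, 2, 2, 1, 1)),
   ((0, 0, 1, 1, 1, 0), (0, 0, 0, 0, 0, 1)), ((0, 0, 1, 1, 1, 0), (0, 1, 0, 1, 1, 1)),
   ((0, 0, 1, 1, 1, 0), (1, 1, 1, 1, 1, 1)), ((0, 0, 1, 1, 1, 0), (1, 1, 1, 2, 1, 1)),
   ((1, 0, 1, 1, 1, 0), (0, 0, 0, 0, 0, 1)), ((1, 0, 1, 1, 1, 0), (0, 1, 0, 1, 1, 1)),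
   ((1, 0, 1, 1, 1, 0), (0, 1, 1, 1, 1, 1)), ((1, 0, 1, 1, 1, 0), (0, 1, 1, 2, 1, 1)),
   ((0, 1, 0, 1, 1, 0), (0, 0, 0, 0, 0, 1)), ((0, 1, 0, 1, 1, 0), (0, 0, 1, 1, 1, 1)),
   ((0, 1, 0, 1, 1, 0), (1, 0, 1, 1, 1, 1)), ((0, 1, 0, 1, 1, 0), (1, 1, 2, 2, 1, 1)),
   ((0, 1, 1, 1, 1, 0), (0, 0, 0, 0, 0, 1)), ((0, 1, 1, 1, 1, 0), (0, 0, 0, 1, 1, 1)),
   ((0, 1, 1, 1, 1, 0), (1, 0, 1, 1, 1, 1)), ((0, 1, 1, 1, 1, 0), (1, 1, 1, 2, 1, 1)),
   ((1, 1, 1, 1, 1, 0), (0, 0, 0, 0, 0, 1)), ((1, 1, 1, 1, 1, 0), (0, 0, 0, 1, 1, 1)),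
   ((1, 1, 1, 1, 1, 0), (0, 0, 1, 1, 1, 1)), ((1, 1, 1, 1, 1, 0), (0, 1, 1, 2, 1, 1)),
   ((0, 1, 1, 2, 1, 0), (0, 0, 0, 0, 0, 1)), ((0, 1, 1, 2, 1, 0), (0, 0, 0, 0, 1, 1)),
   ((0, 1, 1, 2, 1, 0), (1, 0, 1, 1, 1, 1)), ((0, 1, 1, 2, 1, 0), (1, 1, 1, 1, 1, 1)),
   ((1, 1, 1, 2, 1, 0), (0, 0, 0, 0, 0, 1)), ((1, 1, 1, 2, 1, 0), (0, 0, 0, 0, 1, 1)),
   ((1, 1, 1, 2, 1, 0), (0, 0, 1, 1, 1, 1)), ((1, 1, 1, 2, 1, 0), (0, 1, 1, 1, 1, 1)),
   ((1, 1, 2, 2, 1, 0), (0, 0, 0, 0, 0, 1)), ((1, 1, 2, 2, 1, 0), (0, 0, 0, 0, 1, 1)),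
   ((1, 1, 2, 2, 1, 0), (0, 0, 0, 1, 1, 1)), ((1, 1, 2, 2, 1, 0), (0, 1, 0, 1, 1, 1))]"

lemma comb_add: "comb (u + v) = comb u + comb v"
  by (cases u; cases v) (simp add: algebra_simps)

lemma comb_minus: "comb (- u) = - comb u"
  by (cases u) (simp add: algebra_simps)

lemma comb_diff: "comb (u - v) = comb u - comb v"
  using comb_add[of u "- v"] by (simp add: comb_minus)

lemma comb_0: "comb 0 = 0"
  by (simp add: zero_prod_def)

section \<open>The roots in orthonormal coordinates\<close>

text \<open>Twice the coordinates 1 to 5 and 8; the coordinates 6 and 7 are minus the eighth one.\<close>

fun coord_vec :: "coeffs \<Rightarrow> real^8" where
  "coord_vec (x1, x2, x3, x4, x5, y) =
     (of_int x1 / 2) *\<^sub>R unit_vec 1 + (of_int x2 / 2) *\<^sub>R unit_vec 2 + (of_int x3 / 2) *\<^sub>R unit_vec 3 +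
     (of_int x4 / 2) *\<^sub>R unit_vec 4 + (of_int x5 / 2) *\<^sub>R unit_vec 5 +
     (of_int y / 2) *\<^sub>R (unit_vec 8 - unit_vec 7 - unit_vec 6)"

fun coords :: "coeffs \<Rightarrow> coeffs" where
  "coords (a, b, c, d, e, f) =
     (a + 2 * b - 2 * c, 2 * b + 2 * c - 2 * d - a, 2 * d - 2 * e - a, 2 * e - 2 * f - a, 2 * f - a, a)"

lemma comb_coords: "comb u = coord_vec (coords u)"
proof (cases u)
  case (fields a b c d e f)
  have "comb u $ k = coord_vec (coords u) $ k" for k
    unfolding fields comb.simps coords.simps coord_vec.simps
      root_a_def root_b_def root_c_def root_d_def root_e_def root_f_def
    by (simp add: field_simps)
  then show ?thesis by (simp add: vec_eq_iff)
qed

definition axis_coords :: "nat \<Rightarrow> int \<Rightarrow> coeffs" where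
  "axis_coords i t = (if i = 1 then t else 0, if i = 2 then t else 0, if i = 3 then t else 0,
     if i = 4 then t else 0, if i = 5 then t else 0, 0)"

text \<open>The 40 roots supported on two of the first five axes; entries are 2 and -2 because
  coordinates are doubled.\<close>

definition integral_coords :: "coeffs list" where
  "integral_coords = [axis_coords i \<sigma> + axis_coords j \<tau>. i \<leftarrow> [1, 2, 3, 4, 5], j \<leftarrow> [1, 2, 3, 4, 5],
     i < j, \<sigma> \<leftarrow> [2, -2], \<tau> \<leftarrow> [2, -2]]"

text \<open>The 32 remaining roots. Evenness of the sum of the exponents \<nu>(i) becomes the
  condition that the five signs have product 1, and the outer sign \<sigma> is itself the doubled
  eighth coordinate.\<close>

definition half_integral_coords :: "coeffs list" where
  "half_integral_coords = map (\<lambda>(\<sigma>, s1, s2, s3, s4, s5). (\<sigma> * s1, \<sigma> * s2, \<sigma> * s3, \<sigma> * s4, \<sigma> * s5, \<sigma>))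
     (filter (\<lambda>(\<sigma>, s1, s2, s3, s4, s5). s1 * s2 * s3 * s4 * s5 = 1)
       (List.product [1, -1] (List.product [1, -1] (List.product [1, -1]
         (List.product [1, -1] (List.product [1, -1] [1, -1]))))))"

lemma coord_vec_add: "coord_vec (u + v) = coord_vec u + coord_vec v"
  by (cases u; cases v) (simp add: algebra_simps add_divide_distrib)

lemma coord_vec_axis: "i \<in> {1, 2, 3, 4, 5} \<Longrightarrow> coord_vec (axis_coords i t) = (of_int t / 2) *\<^sub>R unit_vec i"
  unfolding axis_coords_def by (elim insertE) simp_all

text \<open>Both sides are explicit lists of 72 integer vectors, so evaluation decides the equality
  of the sets.\<close>

lemma coords_root_list: "set integral_coords \<union> set half_integral_coords = coords ` set root_list"
proof -
  have "set (integral_coords @ half_integral_coords) = set (map coords root_list)"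
    by code_simp
  then show ?thesis by simp
qed

lemma set_integral_coords:
  "set integral_coords =
     {axis_coords i \<sigma> + axis_coords j \<tau> | i j \<sigma> \<tau>. i \<in> {1, 2, 3, 4, 5} \<and> j \<in> {1, 2, 3, 4, 5} \<and> i < j \<and>
        \<sigma> \<in> {2, -2} \<and> \<tau> \<in> {2, -2}}"
  unfolding integral_coords_def by fastforce

lemma set_half_integral_coords:
  "set half_integral_coords =
     (\<lambda>(\<sigma>, s1, s2, s3, s4, s5). (\<sigma> * s1, \<sigma> * s2, \<sigma> * s3, \<sigma> * s4, \<sigma> * s5, \<sigma>)) `
     {(\<sigma>, s1, s2, s3, s4, s5). \<sigma> \<in> {1, -1} \<and> s1 \<in> {1, -1} \<and> s2 \<in> {1, -1} \<and> s3 \<in> {1, -1} \<and>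
        s4 \<in> {1, -1} \<and> s5 \<in> {1, -1} \<and> s1 * s2 * s3 * s4 * s5 = 1}"
  unfolding half_integral_coords_def set_map set_filter set_product
  by (rule arg_cong[where f = "image _"]) auto

lemma interval_5: "{1..5} = {1, 2, 3, 4, 5 :: nat}"
  by auto

lemma E6_coords: "E6 = coord_vec ` (set integral_coords \<union> set half_integral_coords)"
proof -
  let ?A = "{\<sigma> *\<^sub>R unit_vec i + \<tau> *\<^sub>R unit_vec j | \<sigma> \<tau> i j.
        \<sigma> \<in> {1, -1} \<and> \<tau> \<in> {1, -1} \<and> 1 \<le> i \<and> i < j \<and> j \<le> 5}"
  let ?B = "{(\<sigma> / 2) *\<^sub>R (unit_vec 8 - unit_vec 7 - unit_vec 6 + (\<Sum>i=1..5. (-1) ^ \<nu> i *\<^sub>R unit_vec i))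
        | \<sigma> (\<nu> :: nat \<Rightarrow> nat).
        \<sigma> \<in> {1, -1} \<and> (\<forall>i\<in>{1..5}. \<nu> i \<in> {0, 1}) \<and> even (\<Sum>i=1..5. \<nu> i)}"
  have A: "?A = coord_vec ` set integral_coords"
  proof (intro equalityI subsetI)
    fix x assume "x \<in> ?A"
    then obtain \<sigma> \<tau> :: real and i j where x: "x = \<sigma> *\<^sub>R unit_vec i + \<tau> *\<^sub>R unit_vec j"
      and st: "\<sigma> \<in> {1, -1}" "\<tau> \<in> {1, -1}" and ij: "1 \<le> i" "i < j" "j \<le> 5"
      by blast
    obtain s :: int where s: "s \<in> {2, -2}" "\<sigma> = of_int s / 2"
      by (rule that[of "if \<sigma> = 1 then 2 else -2"]) (use st in auto)
    obtain t :: int where t: "t \<in> {2, -2}" "\<tau> = of_int t / 2"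
      by (rule that[of "if \<tau> = 1 then 2 else -2"]) (use st in auto)
    have ij': "i \<in> {1, 2, 3, 4, 5}" "j \<in> {1, 2, 3, 4, 5}"
      using ij by auto
    then have "x = coord_vec (axis_coords i s + axis_coords j t)"
      by (simp only: coord_vec_add coord_vec_axis x s t)
    moreover have "axis_coords i s + axis_coords j t \<in> set integral_coords"
      unfolding set_integral_coords using s t ij ij' by blast
    ultimately show "x \<in> coord_vec ` set integral_coords" by blast
  next
    fix x assume "x \<in> coord_vec ` set integral_coords"
    then obtain s t i j where x: "x = coord_vec (axis_coords i s + axis_coords j t)"
      and st: "s \<in> {2, -2}" "t \<in> {2, -2}"
      and ij: "i \<in> {1, 2, 3, 4, 5}" "j \<in> {1, 2, 3, 4, 5}" "i < j"
      unfolding set_integral_coords by blast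
    have "x = (of_int s / 2) *\<^sub>R unit_vec i + (of_int t / 2) *\<^sub>R unit_vec j"
      by (simp only: coord_vec_add coord_vec_axis x ij)
    moreover have "(of_int s / 2 :: real) \<in> {1, -1}" "(of_int t / 2 :: real) \<in> {1, -1}" "1 \<le> i" "j \<le> 5"
      using st ij by auto
    ultimately show "x \<in> ?A" using \<open>i < j\<close> by blast
  qed
  have B: "?B = coord_vec ` set half_integral_coords"
  proof (intro equalityI subsetI)
    fix x assume "x \<in> ?B"
    then obtain \<sigma> :: real and \<nu> :: "nat \<Rightarrow> nat" where
      x: "x = (\<sigma> / 2) *\<^sub>R (unit_vec 8 - unit_vec 7 - unit_vec 6 + (\<Sum>i=1..5. (-1) ^ \<nu> i *\<^sub>R unit_vec i))"
      and \<sigma>: "\<sigma> \<in> {1, -1}" and ev: "even (\<Sum>i=1..5. \<nu> i)"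
      by blast
    obtain s :: int where s: "s \<in> {1, -1}" "\<sigma> = of_int s"
      by (rule that[of "if \<sigma> = 1 then 1 else -1"]) (use \<sigma> in auto)
    define p :: "nat \<Rightarrow> int" where "p i = (-1) ^ \<nu> i" for i
    have p: "p i \<in> {1, -1}" for i
      unfolding p_def by (cases "even (\<nu> i)") auto
    \<comment> \<open>The product is -1 to the power of the sum of the \<nu>(i).\<close>
    have "p 1 * p 2 * p 3 * p 4 * p 5 = 1"
      using ev unfolding p_def interval_5 by (simp flip: power_add add: add_ac)
    with p s(1) have "(s * p 1, s * p 2, s * p 3, s * p 4, s * p 5, s) \<in> set half_integral_coords"
      unfolding set_half_integral_coords by (intro image_eqI[of _ _ "(s, p 1, p 2, p 3, p 4, p 5)"]) simp_all
    moreover have "x = coord_vec (s * p 1, s * p 2, s * p 3, s * p 4, s * p 5, s)"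
      unfolding x s(2) p_def interval_5 by (simp add: algebra_simps)
    ultimately show "x \<in> coord_vec ` set half_integral_coords" by blast
  next
    fix x assume "x \<in> coord_vec ` set half_integral_coords"
    then obtain t where t: "t \<in> {(\<sigma>, s1, s2, s3, s4, s5). \<sigma> \<in> {1, -1} \<and> s1 \<in> {1, -1} \<and> s2 \<in> {1, -1} \<and>
          s3 \<in> {1, -1} \<and> s4 \<in> {1, -1} \<and> s5 \<in> {1, -1} \<and> s1 * s2 * s3 * s4 * s5 = 1}"
        and xt: "x = coord_vec ((\<lambda>(\<sigma>, s1, s2, s3, s4, s5). (\<sigma> * s1, \<sigma> * s2, \<sigma> * s3, \<sigma> * s4, \<sigma> * s5, \<sigma>)) t)"
      unfolding set_half_integral_coords
      by (elim imageE) (rule that, assumption, erule trans, erule arg_cong)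
    obtain s s1 s2 s3 s4 s5 where t_eq: "t = (s, s1, s2, s3, s4, s5)"
      by (metis surj_pair)
    have x: "x = coord_vec (s * s1, s * s2, s * s3, s * s4, s * s5, s)"
      using xt by (simp only: t_eq prod.case)
    have s: "s \<in> {1, -1}" and p: "s1 \<in> {1, -1}" "s2 \<in> {1, -1}" "s3 \<in> {1, -1}" "s4 \<in> {1, -1}" "s5 \<in> {1, -1}"
        "s1 * s2 * s3 * s4 * s5 = 1"
      using t by (simp_all only: t_eq mem_Collect_eq prod.case)
    \<comment> \<open>The sign 1 gets exponent 0, the sign -1 exponent 1. Axes are counted from 1,
      list positions from 0.\<close>
    define \<nu> :: "nat \<Rightarrow> nat" where
      "\<nu> i = (if [s1, s2, s3, s4, s5] ! (i - 1) = 1 then 0 else 1)" for i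
    have pow: "of_int s1 = (-1 :: real) ^ \<nu> 1" "of_int s2 = (-1 :: real) ^ \<nu> 2" "of_int s3 = (-1 :: real) ^ \<nu> 3"
      "of_int s4 = (-1 :: real) ^ \<nu> 4" "of_int s5 = (-1 :: real) ^ \<nu> 5"
      using p(1-5) unfolding \<nu>_def by auto
    have "x = (of_int s / 2) *\<^sub>R (unit_vec 8 - unit_vec 7 - unit_vec 6 + (\<Sum>i=1..5. (-1) ^ \<nu> i *\<^sub>R unit_vec i))"
      unfolding x interval_5 by (simp add: algebra_simps pow)
    moreover have "even (\<Sum>i=1..5. \<nu> i)"
      unfolding interval_5 using p by (auto simp: \<nu>_def)
    moreover have "(of_int s :: real) \<in> {1, -1}" "\<forall>i\<in>{1..5}. \<nu> i \<in> {0, 1}"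
      using s by (auto simp: \<nu>_def)
    ultimately show "x \<in> ?B" by blast
  qed
  show ?thesis unfolding E6_def A B by (simp only: image_Un)
qed

lemma E6_eq: "E6 = comb ` set root_list"
  unfolding E6_coords coords_root_list by (simp add: image_image comb_coords)

section \<open>Independence of the simple roots and the order\<close>

text \<open>Indices are integers modulo 8, so \<open>of_nat\<close> separates them only within a
  range such as 1 to 8; the index 8 is the residue 0.\<close>

lemma unit_vec_nth:
  assumes "i \<in> {1..8}" "j \<in> {1..8}"
  shows "unit_vec i $ of_nat j = (if i = j then 1 else 0)"
proof -
  have "{1..8} = {1, 2, 3, 4, 5, 6, 7, 8 :: nat}" by auto
  then show ?thesis using assms unfolding unit_vec_def axis_def by (auto simp: axis_def)
qed

text \<open>This is the linear independence of the simple roots. The coordinates 1 to 5 and 8 give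
  six equations; the coordinates 6 and 7 repeat the eighth up to sign.\<close>

lemma simple_coeffs_unique:
  assumes "\<tau>1 *\<^sub>R \<f> + \<tau>2 *\<^sub>R \<e> + \<tau>3 *\<^sub>R \<b> + \<tau>4 *\<^sub>R \<d> + \<tau>5 *\<^sub>R \<c> + \<tau>6 *\<^sub>R \<a> =
     \<tau>1' *\<^sub>R \<f> + \<tau>2' *\<^sub>R \<e> + \<tau>3' *\<^sub>R \<b> + \<tau>4' *\<^sub>R \<d> + \<tau>5' *\<^sub>R \<c> + \<tau>6' *\<^sub>R \<a>" (is "?l = ?r")
  shows "\<tau>1 = \<tau>1' \<and> \<tau>2 = \<tau>2' \<and> \<tau>3 = \<tau>3' \<and> \<tau>4 = \<tau>4' \<and> \<tau>5 = \<tau>5' \<and> \<tau>6 = \<tau>6'"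
proof -
  have nth: "?l $ of_nat j = ?r $ of_nat j" for j
    using assms by simp
  note defs = root_a_def root_b_def root_c_def root_d_def root_e_def root_f_def
  show ?thesis
    using nth[of 1] nth[of 2] nth[of 3] nth[of 4] nth[of 5] nth[of 8]
    unfolding defs vector_add_component vector_minus_component vector_scaleR_component
    by (simp add: unit_vec_nth del: of_nat_numeral of_nat_1 One_nat_def)
qed

lemma comb_cancel: "comb u = comb v \<longleftrightarrow> u = v"
proof
  assume eq: "comb u = comb v"
  obtain a b c d e f a' b' c' d' e' f' where uv: "u = (a, b, c, d, e, f)" "v = (a', b', c', d', e', f')"
    by (metis surj_pair)
  show "u = v"
    using eq simple_coeffs_unique[of "of_int f" "of_int e" "of_int b" "of_int d" "of_int c" "of_int a"
        "of_int f'" "of_int e'" "of_int b'" "of_int d'" "of_int c'" "of_int a'"]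
    unfolding uv by (simp add: add_ac)
qed simp

lemma inj_comb: "inj comb"
  by (simp add: inj_def comb_cancel)

lemma comb_in_E6: "comb u \<in> E6 \<longleftrightarrow> u \<in> set root_list"
  unfolding E6_eq by (simp add: inj_image_mem_iff inj_comb)

text \<open>With six separate reals instead of a coefficient function,
  \<open>simple_coeffs_unique\<close> can be applied.\<close>

lemma prec_iff_first_coeff:
  "x \<prec> y \<longleftrightarrow> (\<exists>\<tau>1 \<tau>2 \<tau>3 \<tau>4 \<tau>5 \<tau>6.
     y - x = \<tau>1 *\<^sub>R \<f> + \<tau>2 *\<^sub>R \<e> + \<tau>3 *\<^sub>R \<b> + \<tau>4 *\<^sub>R \<d> + \<tau>5 *\<^sub>R \<c> + \<tau>6 *\<^sub>R \<a> \<and>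
     (\<tau>1 > 0 \<or> \<tau>1 = 0 \<and> (\<tau>2 > 0 \<or> \<tau>2 = 0 \<and> (\<tau>3 > 0 \<or> \<tau>3 = 0 \<and>
       (\<tau>4 > 0 \<or> \<tau>4 = 0 \<and> (\<tau>5 > 0 \<or> \<tau>5 = 0 \<and> \<tau>6 > 0))))))" (is "_ \<longleftrightarrow> ?R")
proof -
  have ivl: "{1..6} = {1, 2, 3, 4, 5, 6 :: nat}" "{1..<2} = {1 :: nat}" "{1..<3} = {1, 2 :: nat}"
    "{1..<4} = {1, 2, 3 :: nat}" "{1..<5} = {1, 2, 3, 4 :: nat}" "{1..<6} = {1, 2, 3, 4, 5 :: nat}"
    by auto
  have lex: "(\<exists>k\<in>{1..6}. (\<forall>j\<in>{1..<k}. \<tau> j = 0) \<and> \<tau> k > 0) \<longleftrightarrow>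
     (\<tau> 1 > 0 \<or> \<tau> 1 = 0 \<and> (\<tau> 2 > 0 \<or> \<tau> 2 = 0 \<and> (\<tau> 3 > 0 \<or> \<tau> 3 = 0 \<and>
       (\<tau> 4 > 0 \<or> \<tau> 4 = 0 \<and> (\<tau> 5 > 0 \<or> \<tau> 5 = 0 \<and> \<tau> 6 > 0)))))" for \<tau> :: "nat \<Rightarrow> real"
    unfolding ivl by (simp add: ivl[unfolded One_nat_def] atLeastLessThan0) blast
  show ?thesis
  proof
    assume "x \<prec> y"
    then show ?R unfolding prec_def lex by blast
  next
    assume ?R
    then obtain \<tau>1 \<tau>2 \<tau>3 \<tau>4 \<tau>5 \<tau>6 where
      "y - x = \<tau>1 *\<^sub>R \<f> + \<tau>2 *\<^sub>R \<e> + \<tau>3 *\<^sub>R \<b> + \<tau>4 *\<^sub>R \<d> + \<tau>5 *\<^sub>R \<c> + \<tau>6 *\<^sub>R \<a>"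
      "\<tau>1 > 0 \<or> \<tau>1 = 0 \<and> (\<tau>2 > 0 \<or> \<tau>2 = 0 \<and> (\<tau>3 > 0 \<or> \<tau>3 = 0 \<and>
       (\<tau>4 > 0 \<or> \<tau>4 = 0 \<and> (\<tau>5 > 0 \<or> \<tau>5 = 0 \<and> \<tau>6 > 0))))"
      by blast
    then show "x \<prec> y"
      unfolding prec_def lex
      by (intro exI[of _ "\<lambda>k. [\<tau>1, \<tau>2, \<tau>3, \<tau>4, \<tau>5, \<tau>6] ! (k - 1)"]) simp
  qed
qed

text \<open>The coefficients in the definition of the order are arbitrary reals. Independence of the
  simple roots forces them to be the given integers, so comparison of roots becomes a
  computation.\<close>

lemma prec_comb: "comb u \<prec> comb v \<longleftrightarrow> lex_pos (v - u)"
proof -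
  obtain a b c d e f where w: "v - u = (a, b, c, d, e, f)"
    by (metis surj_pair)
  have *: "comb (v - u) = of_int f *\<^sub>R \<f> + of_int e *\<^sub>R \<e> + of_int b *\<^sub>R \<b> +
      of_int d *\<^sub>R \<d> + of_int c *\<^sub>R \<c> + of_int a *\<^sub>R \<a>"
    by (simp add: w add_ac)
  show ?thesis
  proof
    assume "comb u \<prec> comb v"
    then obtain \<tau>1 \<tau>2 \<tau>3 \<tau>4 \<tau>5 \<tau>6 where
      eq: "of_int f *\<^sub>R \<f> + of_int e *\<^sub>R \<e> + of_int b *\<^sub>R \<b> + of_int d *\<^sub>R \<d> + of_int c *\<^sub>R \<c> + of_int a *\<^sub>R \<a> =
        \<tau>1 *\<^sub>R \<f> + \<tau>2 *\<^sub>R \<e> + \<tau>3 *\<^sub>R \<b> + \<tau>4 *\<^sub>R \<d> + \<tau>5 *\<^sub>R \<c> + \<tau>6 *\<^sub>R \<a>" and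
      pos: "\<tau>1 > 0 \<or> \<tau>1 = 0 \<and> (\<tau>2 > 0 \<or> \<tau>2 = 0 \<and> (\<tau>3 > 0 \<or> \<tau>3 = 0 \<and>
        (\<tau>4 > 0 \<or> \<tau>4 = 0 \<and> (\<tau>5 > 0 \<or> \<tau>5 = 0 \<and> \<tau>6 > 0))))"
      unfolding prec_iff_first_coeff comb_diff[symmetric] * by blast
    from pos simple_coeffs_unique[OF eq] show "lex_pos (v - u)"
      unfolding w lex_pos.simps by (metis of_int_0_less_iff of_int_eq_0_iff)
  next
    assume "lex_pos (v - u)"
    then have pos: "lex_pos (a, b, c, d, e, f)" by (simp only: w)
    show "comb u \<prec> comb v"
      unfolding prec_iff_first_coeff comb_diff[symmetric] *
      by (intro exI conjI, rule refl) (use pos in simp)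
  qed
qed

section \<open>Inner products and the sign cocycle\<close>

lemma unit_vec_inner:
  assumes "i \<in> {1..8}" "j \<in> {1..8}"
  shows "unit_vec i \<bullet> unit_vec j = (if i = j then 1 else 0)"
proof -
  have "unit_vec i \<bullet> unit_vec j = unit_vec i $ of_nat j"
    unfolding unit_vec_def[of j] by (simp add: inner_axis)
  then show ?thesis using unit_vec_nth[OF assms] by simp
qed

declare comb.simps [simp del]

text \<open>
  The Euler form of an orientation of the Dynkin diagram; any orientation would do, with other
  signs in \<open>scaling_table\<close> below.
\<close>

definition euler_form :: "coeffs \<Rightarrow> coeffs \<Rightarrow> int" where
  "euler_form u v = (case (u, v) of ((a, b, c, d, e, f), (a', b', c', d', e', f')) \<Rightarrow>
     a * a' + b * b' + c * c' + d * d' + e * e' + f * f'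
     - c * a' - d * c' - d * e' - e * f' - b * d')"

text \<open>The factor 3 is the squared length of
  \<open>unit_vec 8 - unit_vec 7 - unit_vec 6\<close>; the denominator 4 comes from doubling both
  vectors.\<close>

lemma coord_vec_inner:
  "coord_vec (x1, x2, x3, x4, x5, y) \<bullet> coord_vec (x1', x2', x3', x4', x5', y') =
     of_int (x1 * x1' + x2 * x2' + x3 * x3' + x4 * x4' + x5 * x5' + 3 * y * y') / 4"
  unfolding coord_vec.simps
  by (simp add: inner_add_left inner_add_right inner_diff_left inner_diff_right unit_vec_inner
      del: One_nat_def)

lemma comb_inner: "comb u \<bullet> comb v = of_int (euler_form u v + euler_form v u)"
proof -
  obtain a b c d e f a' b' c' d' e' f' where uv: "u = (a, b, c, d, e, f)" "v = (a', b', c', d', e', f')"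
    by (metis surj_pair)
  show ?thesis
    unfolding comb_coords uv coords.simps coord_vec_inner by (simp add: euler_form_def field_simps)
qed

text \<open>This is -1 to the power \<open>euler_form u v\<close>, expressed by parity because the
  exponent may be negative.\<close>

definition comb_sign :: "coeffs \<Rightarrow> coeffs \<Rightarrow> int" where
  "comb_sign u v = (if even (euler_form u v) then 1 else -1)"

lemma euler_form_add_left: "euler_form (u + v) w = euler_form u w + euler_form v w"
  by (cases u; cases v; cases w) (simp add: euler_form_def algebra_simps)

lemma euler_form_add_right: "euler_form u (v + w) = euler_form u v + euler_form u w"
  by (cases u; cases v; cases w) (simp add: euler_form_def algebra_simps)

text \<open>By bilinearity both sides have exponent B(u,v) + B(u,w) + B(v,w), where B is
  \<open>euler_form\<close>.\<close>

lemma comb_sign_cocycle: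
  "comb_sign u (v + w) * comb_sign v w = comb_sign u v * comb_sign (u + v) w"
  by (simp add: comb_sign_def euler_form_add_left euler_form_add_right)

lemma comb_sign_square: "comb_sign u v * comb_sign u v = 1"
  by (simp add: comb_sign_def)

text \<open>The squared length of \<open>comb u\<close> is twice \<open>euler_form u u\<close>, and
  the latter evaluates to 1 on the whole list.\<close>

lemma root_norm:
  assumes "r \<in> E6"
  shows "r \<bullet> r = 2"
proof -
  have "\<forall>u\<in>set root_list. euler_form u u = 1"
    by code_simp
  with assms show ?thesis
    unfolding E6_eq by (auto simp: comb_inner)
qed

lemma root_minus:
  assumes "r \<in> E6"
  shows "- r \<in> E6"
proof -
  obtain u where u: "r = comb u" "u \<in> set pos_roots \<or> (\<exists>w\<in>set pos_roots. u = - w)"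
    using assms unfolding E6_eq root_list_def set_append set_map by blast
  then have "- u \<in> set root_list"
    unfolding root_list_def by (elim disjE bexE) simp_all
  then have "comb (- u) \<in> E6"
    unfolding E6_eq by blast
  then show ?thesis by (simp add: comb_minus u(1))
qed

text \<open>Expand the squared length of r + s, where all three squared lengths are 2. The case r =
  s shows later that twice a root is not a root.\<close>

lemma root_inner_of_root_sum:
  assumes "r \<in> E6" "s \<in> E6" "r + s \<in> E6"
  shows "r \<bullet> s = -1"
  using root_norm[OF assms(1)] root_norm[OF assms(2)] root_norm[OF assms(3)]
  by (simp add: inner_add_left inner_add_right inner_commute)

text \<open>The inner product -1 is odd, so \<open>euler_form u v\<close> and
  \<open>euler_form v u\<close> have different parity.\<close>

lemma comb_sign_swap:
  assumes "comb u \<in> E6" "comb v \<in> E6" "comb (u + v) \<in> E6"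
  shows "comb_sign v u = - comb_sign u v"
proof -
  have "of_int (euler_form u v + euler_form v u) = (-1 :: real)"
    using root_inner_of_root_sum[OF assms(1,2)] assms(3) by (simp add: comb_add comb_inner)
  then have "euler_form u v + euler_form v u = -1"
    by linarith
  then have "odd (euler_form u v + euler_form v u)"
    by simp
  then show ?thesis
    by (auto simp: comb_sign_def)
qed

lemma E6_positive: "{r \<in> E6. 0 \<prec> r} = comb ` set pos_roots"
proof -
  have "(\<forall>u\<in>set pos_roots. lex_pos u) \<and> (\<forall>u\<in>set pos_roots. \<not> lex_pos (- u))"
    by code_simp
  then show ?thesis
    unfolding E6_eq root_list_def using prec_comb[of 0] by (auto simp: comb_0)
qed

section \<open>Special and extraspecial pairs\<close>

text \<open>Since roots have squared length 2, their inner product is the Cartan integer; as an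
  integer it can be evaluated.\<close>

definition cartan_int :: "coeffs \<Rightarrow> coeffs \<Rightarrow> int" where
  "cartan_int u v = euler_form u v + euler_form v u"

text \<open>Used mainly in contraposed form: a Cartan integer other than -1 shows that u + v is not
  a root without searching the list.\<close>

lemma cartan_int_of_root_sum:
  assumes "u \<in> set root_list" "v \<in> set root_list" "u + v \<in> set root_list"
  shows "cartan_int u v = -1"
proof -
  have "of_int (cartan_int u v) = (-1 :: real)"
    using root_inner_of_root_sum[of "comb u" "comb v"] assms
    by (simp add: comb_in_E6 comb_inner cartan_int_def flip: comb_add)
  then show ?thesis by linarith
qed

text \<open>The first 30 entries of \<^const>\<open>special_pairs\<close> are the extraspecial ones.\<close>

definition extraspecial_pairs :: "(coeffs \<times> coeffs) list" where
  "extraspecial_pairs = take 30 special_pairs"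

text \<open>
  The first component of the extraspecial pair with sum \<open>w\<close>: the \<open>\<prec>\<close>-least simple root whose inner
  product with \<open>w\<close> is 1.
\<close>

fun least_summand :: "coeffs \<Rightarrow> coeffs" where
  "least_summand (a, b, c, d, e, f) =
     (if 2 * a - c = 1 then (1, 0, 0, 0, 0, 0)
      else if 2 * c - a - d = 1 then (0, 0, 1, 0, 0, 0)
      else if 2 * d - b - c - e = 1 then (0, 0, 0, 1, 0, 0)
      else if 2 * b - d = 1 then (0, 1, 0, 0, 0, 0)
      else (0, 0, 0, 0, 1, 0))"

lemmas root_tables =
  pos_roots_def special_pairs_def extraspecial_pairs_def cartan_int_def euler_form_def zero_prod_def

text \<open>The first six entries of \<open>pos_roots\<close> are the simple roots, so the last
  conjunct places the sum among the roots that index the extraspecial pairs.\<close>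

lemma special_pair_cases:
  assumes "(u, v) \<in> set special_pairs"
  shows "u \<in> set pos_roots \<and> v \<in> set pos_roots \<and> lex_pos (v - u) \<and> u + v \<in> set (drop 6 pos_roots)"
proof -
  have "list_all (\<lambda>(u, v). u \<in> set pos_roots \<and> v \<in> set pos_roots \<and> lex_pos (v - u) \<and> u + v \<in> set (drop 6 pos_roots))
      special_pairs"
    by (simp add: root_tables)
  then show ?thesis
    using assms unfolding list_all_iff by blast
qed

text \<open>By \<open>cartan_int_of_root_sum\<close>, only pairs with Cartan integer \<open>-1\<close> have to be inspected.\<close>

lemma special_pairs_eq:
  "set special_pairs =
     {(u, v). u \<in> set pos_roots \<and> v \<in> set pos_roots \<and> lex_pos (v - u) \<and> u + v \<in> set pos_roots}"
proof (intro equalityI subsetI)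
  show "p \<in> {(u, v). u \<in> set pos_roots \<and> v \<in> set pos_roots \<and> lex_pos (v - u) \<and> u + v \<in> set pos_roots}"
    if "p \<in> set special_pairs" for p
    using that special_pair_cases in_set_dropD[of _ 6 pos_roots] by blast
next
  fix p assume "p \<in> {(u, v). u \<in> set pos_roots \<and> v \<in> set pos_roots \<and> lex_pos (v - u) \<and> u + v \<in> set pos_roots}"
  then obtain u v where p: "p = (u, v)" and uv: "u \<in> set pos_roots" "v \<in> set pos_roots" "lex_pos (v - u)"
    "u + v \<in> set pos_roots"
    by blast
  have "cartan_int u v = -1"
    using uv by (intro cartan_int_of_root_sum) (simp_all add: root_list_def)
  moreover have "list_all (\<lambda>u. list_all (\<lambda>v.
      cartan_int u v = -1 \<longrightarrow> lex_pos (v - u) \<longrightarrow> (u, v) \<in> set special_pairs)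
      pos_roots) pos_roots"
    by (simp add: root_tables)
  ultimately show "p \<in> set special_pairs"
    using uv unfolding p list_all_iff by blast
qed

lemma distinct_special_pairs: "distinct special_pairs"
  by (simp add: special_pairs_def)

text \<open>An extraspecial pair is determined by its sum, and every non-simple positive root occurs
  as such a sum.\<close>

lemma extraspecial_pairs_sums:
  "extraspecial_pairs = map (\<lambda>w. (least_summand w, w - least_summand w)) (drop 6 pos_roots)"
  by (simp add: root_tables)

lemma extraspecial_pair_of_sum:
  assumes "(u, v) \<in> set special_pairs"
  shows "(least_summand (u + v), u + v - least_summand (u + v)) \<in> set extraspecial_pairs"
  unfolding extraspecial_pairs_sums using special_pair_cases[OF assms] by simp

lemma extraspecial_imp_special: "p \<in> set extraspecial_pairs \<Longrightarrow> p \<in> set special_pairs"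
  unfolding extraspecial_pairs_def by (rule in_set_takeD)

lemma least_summand_le:
  assumes "(u, v) \<in> set special_pairs"
  shows "least_summand (u + v) = u \<or> lex_pos (u - least_summand (u + v))"
proof -
  have "list_all (\<lambda>(u, v). least_summand (u + v) = u \<or> lex_pos (u - least_summand (u + v))) special_pairs"
    by (simp add: root_tables)
  then show ?thesis
    using assms unfolding list_all_iff by blast
qed

lemma lex_pos_minus: "lex_pos u \<Longrightarrow> \<not> lex_pos (- u)"
  by (cases u) auto

text \<open>A pair with least first component and the listed pair of the same sum each have a first
  component at most that of the other. Antisymmetry identifies these components, and the sum fixes
  the second ones.\<close>

lemma extraspecial_pairs_eq:
  "set extraspecial_pairs =
     {(u, v) \<in> set special_pairs. \<forall>(u', v') \<in> set special_pairs. u' + v' = u + v \<longrightarrow> lex_pos (u' - u) \<or> u = u'}"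
proof (intro equalityI subsetI)
  fix p assume p: "p \<in> set extraspecial_pairs"
  then obtain w where w: "p = (least_summand w, w - least_summand w)"
    unfolding extraspecial_pairs_sums by auto
  have "lex_pos (u' - least_summand w) \<or> least_summand w = u'"
    if "(u', v') \<in> set special_pairs" "u' + v' = least_summand w + (w - least_summand w)" for u' v'
    using least_summand_le[OF that(1)] that(2) by auto
  then show "p \<in> {(u, v) \<in> set special_pairs.
      \<forall>(u', v') \<in> set special_pairs. u' + v' = u + v \<longrightarrow> lex_pos (u' - u) \<or> u = u'}"
    using extraspecial_imp_special[OF p] unfolding w by blast
next
  fix p assume "p \<in> {(u, v) \<in> set special_pairs.
      \<forall>(u', v') \<in> set special_pairs. u' + v' = u + v \<longrightarrow> lex_pos (u' - u) \<or> u = u'}"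
  then obtain u v where p: "p = (u, v)" and uv: "(u, v) \<in> set special_pairs"
    and least: "\<forall>(u', v') \<in> set special_pairs. u' + v' = u + v \<longrightarrow> lex_pos (u' - u) \<or> u = u'"
    by blast
  let ?u = "least_summand (u + v)"
  have "lex_pos (?u - u) \<or> u = ?u"
    using least extraspecial_imp_special[OF extraspecial_pair_of_sum[OF uv]] by fastforce
  with least_summand_le[OF uv] have "?u = u"
    using lex_pos_minus[of "u - ?u"] by auto
  then show "p \<in> set extraspecial_pairs"
    using extraspecial_pair_of_sum[OF uv] by (simp add: p)
qed

text \<open>
  If \<open>(u', v')\<close> is the extraspecial pair with the same sum, then, up to exchanging \<open>u\<close> and \<open>v\<close>, the
  roots \<open>u\<close>, \<open>q = v - u'\<close>, \<open>u'\<close> are a triple for the Jacobi identity with \<open>q + u' = v\<close> and \<open>u + q = v'\<close>.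
\<close>

lemma special_pair_descent:
  assumes "(u, v) \<in> set special_pairs" "(u, v) \<notin> set extraspecial_pairs"
  defines "u' \<equiv> least_summand (u + v)"
  shows "v - u' \<in> set pos_roots \<and> cartan_int u u' \<noteq> -1 \<or> u - u' \<in> set pos_roots \<and> cartan_int v u' \<noteq> -1"
proof -
  \<comment> \<open>The differences and Cartan integers are tabulated and evaluated first;
    \<open>list.pred_map\<close> then turns the result back into a statement about the
    pairs.\<close>
  have "list_all (\<lambda>(ext, q, c, q', c'). ext \<or> q \<in> set pos_roots \<and> c \<noteq> -1 \<or> q' \<in> set pos_roots \<and> c' \<noteq> -1)
      (map (\<lambda>(u, v). (least_summand (u + v) = u,
         v - least_summand (u + v), cartan_int u (least_summand (u + v)),
         u - least_summand (u + v), cartan_int v (least_summand (u + v)))) special_pairs)"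
    by (simp add: root_tables)
  then have "list_all (\<lambda>(u, v). least_summand (u + v) = u \<or>
      v - least_summand (u + v) \<in> set pos_roots \<and> cartan_int u (least_summand (u + v)) \<noteq> -1 \<or>
      u - least_summand (u + v) \<in> set pos_roots \<and> cartan_int v (least_summand (u + v)) \<noteq> -1) special_pairs"
    by (simp only: list.pred_map comp_def case_prod_unfold fst_conv snd_conv)
  moreover have "u' \<noteq> u"
    using extraspecial_pair_of_sum[OF assms(1)] assms(2) by (auto simp: u'_def)
  ultimately show ?thesis
    using assms(1) unfolding u'_def list_all_iff by blast
qed

lemma lex_pos_add: "lex_pos u \<Longrightarrow> lex_pos v \<Longrightarrow> lex_pos (u + v)"
  by (cases u; cases v) auto

lemma lex_pos_total: "lex_pos u \<or> u = 0 \<or> lex_pos (- u)"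
  by (cases u) (auto simp: zero_prod_def)

lemma lex_pos_irrefl: "\<not> lex_pos 0"
  by (simp add: zero_prod_def)

lemma pos_root_iff: "u \<in> set pos_roots \<longleftrightarrow> comb u \<in> E6 \<and> lex_pos u"
proof -
  have "u \<in> set pos_roots \<longleftrightarrow> comb u \<in> {r \<in> E6. 0 \<prec> r}"
    unfolding E6_positive by (simp only: inj_image_mem_iff[OF inj_comb])
  then show ?thesis
    using prec_comb[of 0 u] by (simp add: comb_0)
qed

lemma prec_rootsE:
  fixes r s :: "real^8"
  assumes "r \<in> E6" "s \<in> E6" "0 \<prec> r" "r \<prec> s"
  obtains u v where "r = comb u" "s = comb v" "u \<in> set pos_roots" "v \<in> set pos_roots" "lex_pos (v - u)"
proof -
  obtain u v where uv: "r = comb u" "s = comb v"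
    using assms(1,2) unfolding E6_eq by blast
  have "lex_pos u" "lex_pos (v - u)"
    using assms(3,4) prec_comb[of 0 u] by (simp_all add: uv comb_0 prec_comb)
  moreover from this have "lex_pos v"
    using lex_pos_add[of u "v - u"] by simp
  ultimately show thesis
    using assms(1,2) that uv pos_root_iff by blast
qed

section \<open>Special and extraspecial pairs of vectors\<close>

definition comb_pair :: "coeffs \<times> coeffs \<Rightarrow> (real^8) \<times> (real^8)" where
  "comb_pair p = (comb (fst p), comb (snd p))"

lemma inj_comb_pair: "inj comb_pair"
  by (auto simp: inj_def comb_pair_def comb_cancel prod_eq_iff)

lemma special_comb: "special (comb u) (comb v) \<longleftrightarrow> (u, v) \<in> set special_pairs"
proof
  assume sp: "special (comb u) (comb v)"
  then have "u \<in> set pos_roots" "v \<in> set pos_roots" "lex_pos (v - u)"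
    unfolding special_def using comb_cancel by (metis prec_rootsE)+
  moreover from this have "u + v \<in> set pos_roots"
    using sp lex_pos_add[of u v] unfolding special_def pos_root_iff comb_add by blast
  ultimately show "(u, v) \<in> set special_pairs"
    unfolding special_pairs_eq by blast
next
  assume "(u, v) \<in> set special_pairs"
  then show "special (comb u) (comb v)"
    using prec_comb[of 0 u] unfolding special_pairs_eq special_def
    by (simp add: pos_root_iff comb_0 comb_add prec_comb)
qed

lemma special_set: "{(r, s). special r s} = comb_pair ` set special_pairs"
proof (intro equalityI subsetI)
  fix p assume "p \<in> {(r, s). special r s}"
  then obtain r s where rs: "p = (r, s)" "special r s" by blast
  then obtain u v where "r = comb u" "s = comb v"
    unfolding special_def E6_eq by blast
  with rs show "p \<in> comb_pair ` set special_pairs"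
    by (auto simp: special_comb comb_pair_def intro!: image_eqI[of _ _ "(u, v)"])
next
  fix p assume "p \<in> comb_pair ` set special_pairs"
  then show "p \<in> {(r, s). special r s}"
    by (auto simp: comb_pair_def special_comb)
qed

lemma extraspecial_comb: "extraspecial (comb u) (comb v) \<longleftrightarrow> (u, v) \<in> set extraspecial_pairs"
proof -
  have "(\<forall>r s. special r s \<and> r + s = comb u + comb v \<longrightarrow> comb u \<prec> r \<or> comb u = r) \<longleftrightarrow>
      (\<forall>p \<in> {(r, s). special r s}. fst p + snd p = comb u + comb v \<longrightarrow> comb u \<prec> fst p \<or> comb u = fst p)"
    by auto
  also have "\<dots> \<longleftrightarrow> (\<forall>(u', v') \<in> set special_pairs. u' + v' = u + v \<longrightarrow> lex_pos (u' - u) \<or> u = u')"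
    unfolding special_set by (auto simp: comb_pair_def prec_comb comb_cancel simp flip: comb_add)
  finally show ?thesis
    unfolding extraspecial_def extraspecial_pairs_eq special_comb by blast
qed

lemma extraspecial_set: "{(r, s). extraspecial r s} = comb_pair ` set extraspecial_pairs"
proof (intro equalityI subsetI)
  fix p assume "p \<in> {(r, s). extraspecial r s}"
  then obtain r s where rs: "p = (r, s)" "extraspecial r s" by blast
  then obtain u v where "r = comb u" "s = comb v"
    unfolding extraspecial_def special_def E6_eq by blast
  with rs show "p \<in> comb_pair ` set extraspecial_pairs"
    by (auto simp: extraspecial_comb comb_pair_def intro!: image_eqI[of _ _ "(u, v)"])
next
  fix p assume "p \<in> comb_pair ` set extraspecial_pairs"
  then show "p \<in> {(r, s). extraspecial r s}"
    by (auto simp: comb_pair_def extraspecial_comb)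
qed

fun height :: "coeffs \<Rightarrow> int" where
  "height (a, b, c, d, e, f) = a + b + c + d + e + f"

lemma height_add: "height (u + v) = height u + height v"
  by (cases u; cases v) simp

lemma height_pos_roots: "u \<in> set pos_roots \<Longrightarrow> height u > 0"
proof -
  have "list_all (\<lambda>u. height u > 0) pos_roots"
    by (simp add: pos_roots_def)
  then show "u \<in> set pos_roots \<Longrightarrow> height u > 0"
    unfolding list_all_iff by blast
qed

section \<open>Identities between structure constants\<close>

locale E6_chevalley = lie_algebra scale br
  for scale :: "complex \<Rightarrow> 'g::ab_group_add \<Rightarrow> 'g" and br :: "'g \<Rightarrow> 'g \<Rightarrow> 'g" +
  fixes H :: "'g set" and \<phi> :: "real^8 \<Rightarrow> 'g \<Rightarrow> complex" and h e :: "real^8 \<Rightarrow> 'g"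
    and N :: "real^8 \<Rightarrow> real^8 \<Rightarrow> int"
  assumes subspace_H: "subspace H"
    and root_iso: "E6_root_iso H \<phi>"
    and chevalley: "chevalley_basis H \<phi> h e"
    and constants: "structure_constants e N"
begin

lemma br_zero_left [simp]: "br 0 x = 0"
  using br_add_left[of 0 0 x] by simp

lemma br_zero_right [simp]: "br x 0 = 0"
  using br_add_right[of x 0 0] by simp

lemma br_anticommute: "br y x = - br x y"
proof -
  have "br (x + y) (x + y) = br x y + br y x"
    by (simp only: br_add_left br_add_right) (simp add: br_self)
  then have "br x y + br y x = 0"
    by (simp only: br_self)
  then show ?thesis by (rule minus_unique[symmetric])
qed

lemma e_nonzero: "r \<in> E6 \<Longrightarrow> e r \<noteq> 0"
  using chevalley dependent_zero[of "h ` simple_roots \<union> e ` E6"]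
  unfolding chevalley_basis_def by (metis UnI2 image_eqI)

lemma h_in_H: "r \<in> E6 \<Longrightarrow> h r \<in> H"
  using chevalley unfolding chevalley_basis_def is_coroot_def by blast

lemma e_in_root_space: "r \<in> E6 \<Longrightarrow> e r \<in> root_space H (\<phi> r)"
  using chevalley unfolding chevalley_basis_def by blast

lemma br_e_opposite: "r \<in> E6 \<Longrightarrow> br (e r) (e (- r)) = h r"
  using chevalley unfolding chevalley_basis_def by blast

lemma br_e: "r \<in> E6 \<Longrightarrow> s \<in> E6 \<Longrightarrow> r + s \<in> E6 \<Longrightarrow> br (e r) (e s) = scale (of_int (N r s)) (e (r + s))"
  using constants unfolding structure_constants_def by blast

lemma N_zero: "r \<in> E6 \<Longrightarrow> s \<in> E6 \<Longrightarrow> r + s \<notin> E6 \<Longrightarrow> r + s \<noteq> 0 \<Longrightarrow> N r s = 0"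
  using constants unfolding structure_constants_def by blast

lemma phi_h: 
  assumes "r \<in> E6" "s \<in> E6"
  shows "\<phi> s (h r) = of_real (s \<bullet> r)"
proof -
  have "is_coroot H (\<phi> r) (h r)"
    using chevalley assms unfolding chevalley_basis_def by blast
  then have "\<phi> s (h r) = of_real (2 * (s \<bullet> r) / (r \<bullet> r))"
    using root_iso assms unfolding E6_root_iso_def by blast
  then show ?thesis by (simp add: root_norm[OF assms(1)])
qed

lemma phi_in_functionals: "r \<in> E6 \<Longrightarrow> \<phi> r \<in> functionals H"
  using root_iso unfolding E6_root_iso_def roots_def bij_betw_def by blast

lemma br_h_e: "r \<in> E6 \<Longrightarrow> s \<in> E6 \<Longrightarrow> br (h r) (e s) = scale (of_real (s \<bullet> r)) (e s)"
  using e_in_root_space[of s] h_in_H[of r] by (simp add: root_space_def phi_h)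

text \<open>\<open>structure_constants\<close> only sets N to 0 here; that the bracket itself
  vanishes needs proof. A nonzero bracket would make the functional \<phi> r + \<phi> s a root,
  hence \<phi> t for some t in \<open>E6\<close>, and the values at the coroots would give r + s =
  t.\<close>

lemma br_e_nonroot:
  assumes r: "r \<in> E6" and s: "s \<in> E6" and nonroot: "r + s \<notin> E6" "r + s \<noteq> 0"
  shows "br (e r) (e s) = 0"
proof (rule ccontr)
  assume nz: "br (e r) (e s) \<noteq> 0"
  \<comment> \<open>Functionals on H are \<open>undefined\<close> outside H, so the sum has to be
    restricted.\<close>
  define \<mu> where "\<mu> = restrict (\<lambda>t. \<phi> r t + \<phi> s t) H"
  have closed: "x + y \<in> H" "scale c x \<in> H" if "x \<in> H" "y \<in> H" for x y c
    using subspace_H that by (auto simp: subspace_add subspace_scale)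
  have \<mu>_fun: "\<mu> \<in> functionals H"
    using phi_in_functionals[OF r] phi_in_functionals[OF s] closed
    by (simp add: functionals_def \<mu>_def algebra_simps)
  have \<mu>_h: "\<mu> (h u) = of_real ((r + s) \<bullet> u)" if "u \<in> E6" for u
    using phi_h[OF that r] phi_h[OF that s] h_in_H[OF that] by (simp add: \<mu>_def inner_add_left)
  have nz_H: "\<exists>y\<in>H. \<mu> y \<noteq> 0"
  proof (rule ccontr)
    assume "\<not> ?thesis"
    then have "(r + s) \<bullet> u = 0" if "u \<in> E6" for u
      using \<mu>_h[OF that] h_in_H[OF that] by auto
    \<comment> \<open>A vector orthogonal to r and to s is orthogonal to r + s.\<close>
    then have "(r + s) \<bullet> (r + s) = 0"
      using r s by (simp add: inner_add_right)
    then show False using nonroot by simp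
  qed
  have "br (e r) (e s) \<in> root_space H \<mu>"
    unfolding root_space_def
  proof (intro CollectI ballI)
    fix y assume y: "y \<in> H"
    have *: "br y (e r) = scale (\<phi> r y) (e r)" "br y (e s) = scale (\<phi> s y) (e s)"
      using e_in_root_space r s y unfolding root_space_def by auto
    \<comment> \<open>Bracketing with y is a derivation, by the Jacobi identity.\<close>
    have "br y (br (e r) (e s)) = br (br y (e r)) (e s) + br (e r) (br y (e s))"
      using jacobi[of y "e r" "e s"] br_anticommute[of "e s" y] br_anticommute[of "e s" "br y (e r)"]
        br_anticommute[of "br y (e r)" "e s"] * br_scale_right[of "e r" "- \<phi> s y" "e s"]
      by (simp add: br_scale_left br_scale_right scale_minus_left add_eq_0_iff algebra_simps)
    then show "br y (br (e r) (e s)) = scale (\<mu> y) (br (e r) (e s))"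
      using y by (simp add: * br_scale_left br_scale_right \<mu>_def scale_left_distrib)
  qed
  then have "\<mu> \<in> roots H"
    using \<mu>_fun nz_H nz unfolding roots_def by blast
  then obtain t where t: "t \<in> E6" "\<mu> = \<phi> t"
    using root_iso unfolding E6_root_iso_def bij_betw_def by blast
  \<comment> \<open>Evaluate \<mu> = \<phi> t at the coroot of u. Being orthogonal to r, s and t,
    the vector r + s - t is orthogonal to itself.\<close>
  have "(r + s - t) \<bullet> u = 0" if "u \<in> E6" for u
  proof -
    have "of_real ((r + s) \<bullet> u) = (of_real (t \<bullet> u) :: complex)"
      using \<mu>_h[OF that] phi_h[OF that t(1)] t(2) by simp
    then have "(r + s) \<bullet> u = t \<bullet> u"
      by (simp only: of_real_eq_iff)
    then show ?thesis
      by (simp add: inner_diff_left)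
  qed
  then have "(r + s - t) \<bullet> (r + s - t) = 0"
    using r s t(1) by (simp add: inner_add_right inner_diff_right)
  then have "r + s = t" by simp
  then show False using t(1) nonroot by simp
qed

lemma N_unit:
  assumes "r \<in> E6" "s \<in> E6" "r + s \<in> E6"
  shows "N r s = 1 \<or> N r s = -1"
proof -
  have "br (e r) (e s) = e (r + s) \<or> br (e r) (e s) = - e (r + s)"
    using chevalley assms unfolding chevalley_basis_def by blast
  then have "scale (of_int (N r s)) (e (r + s)) = scale (of_int 1) (e (r + s)) \<or>
      scale (of_int (N r s)) (e (r + s)) = scale (of_int (-1)) (e (r + s))"
    using br_e[OF assms] by simp
  then have "of_int (N r s) = (of_int 1 :: complex) \<or> of_int (N r s) = (of_int (-1) :: complex)"
    using e_nonzero[OF assms(3)] by (simp only: scale_cancel_right) blast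
  then show ?thesis by (simp only: of_int_eq_iff)
qed

lemma N_swap:
  assumes "r \<in> E6" "s \<in> E6" "r + s \<in> E6"
  shows "N s r = - N r s"
proof -
  have "scale (of_int (N s r)) (e (r + s)) = scale (of_int (- N r s)) (e (r + s))"
    using br_e[of r s] br_e[of s r] br_anticommute[of "e s" "e r"] assms by (simp add: add.commute)
  then have "(of_int (N s r) :: complex) = of_int (- N r s)"
    using e_nonzero[OF assms(3)] by (simp only: scale_cancel_right) blast
  then show ?thesis by (simp only: of_int_eq_iff)
qed

text \<open>If s + t is not a root, both sides vanish: the inner bracket by
  \<open>br_e_nonroot\<close>, the scalar because N s t = 0.\<close>

lemma br_br_e:
  assumes "r \<in> E6" "s \<in> E6" "t \<in> E6" "s + t \<noteq> 0" "r + s + t \<in> E6"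
  shows "br (e r) (br (e s) (e t)) = scale (of_int (N r (s + t) * N s t)) (e (r + s + t))"
proof (cases "s + t \<in> E6")
  case True
  then show ?thesis
    using assms br_e[of s t] br_e[of r "s + t"] by (simp add: br_scale_right add.assoc mult.commute)
next
  case False
  then show ?thesis
    using assms br_e_nonroot[of s t] N_zero[of s t] by simp
qed

lemma N_cocycle:
  assumes xyz: "x \<in> E6" "y \<in> E6" "z \<in> E6" "x + y + z \<in> E6"
    and xy: "x + y \<in> E6" and yz: "y + z \<in> E6" and xz: "x + z \<notin> E6" "x + z \<noteq> 0"
  shows "N x (y + z) * N y z = N x y * N (x + y) z"
proof -
  have nz: "x + y \<noteq> 0" "y + z \<noteq> 0"
    using root_norm[OF xy] root_norm[OF yz] by auto
  have "br (e x) (br (e y) (e z)) + br (e y) (br (e z) (e x)) + br (e z) (br (e x) (e y)) = 0"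
    by (rule jacobi)
  moreover have "br (e z) (e x) = 0"
    using br_e_nonroot[of z x] xyz xz by (simp add: add.commute)
  moreover have "br (e x) (br (e y) (e z)) = scale (of_int (N x (y + z) * N y z)) (e (x + y + z))"
    using br_br_e[of x y z] xyz nz by simp
  moreover have "br (e z) (br (e x) (e y)) = scale (of_int (N z (x + y) * N x y)) (e (x + y + z))"
    using br_br_e[of z x y] xyz nz by (simp add: add_ac)
  ultimately have "scale (of_int (N x (y + z) * N y z + N z (x + y) * N x y)) (e (x + y + z)) = 0"
    by (simp add: scale_left_distrib)
  then have "(of_int (N x (y + z) * N y z + N z (x + y) * N x y) :: complex) = of_int 0"
    using e_nonzero[OF xyz(4)] by (simp only: scale_eq_0_iff of_int_0) blast
  then have "N x (y + z) * N y z + N z (x + y) * N x y = 0"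
    by (simp only: of_int_eq_iff)
  moreover have "N z (x + y) = - N (x + y) z"
    using N_swap[of "x + y" z] xyz xy by (simp add: add_ac)
  ultimately show ?thesis by (simp add: algebra_simps)
qed

text \<open>The Jacobi identity for the three root vectors is a linear relation between the coroots
  of r, s, t with coefficients N s t, N t r, N r s. Bracketing it with \<open>e r\<close> replaces
  the coroots by the inner products 2, -1, -1.\<close>

lemma N_cyclic_aux:
  assumes rst: "r \<in> E6" "s \<in> E6" "t \<in> E6" "r + s + t = 0"
  shows "2 * N s t = N t r + N r s"
proof -
  have sums: "s + t = - r" "t + r = - s" "r + s = - t"
    using rst(4) by (simp_all only: eq_neg_iff_add_eq_0 add_ac)
  have "br (e r) (br (e s) (e t)) = scale (of_int (N s t)) (h r)"
    using br_e[of s t] rst sums root_minus by (simp add: br_scale_right br_e_opposite)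
  moreover have "br (e s) (br (e t) (e r)) = scale (of_int (N t r)) (h s)"
    using br_e[of t r] rst sums root_minus by (simp add: br_scale_right br_e_opposite)
  moreover have "br (e t) (br (e r) (e s)) = scale (of_int (N r s)) (h t)"
    using br_e[of r s] rst sums root_minus by (simp add: br_scale_right br_e_opposite)
  ultimately have "br (scale (of_int (N s t)) (h r) + scale (of_int (N t r)) (h s) + scale (of_int (N r s)) (h t)) (e r) = 0"
    using jacobi[of "e r" "e s" "e t"] by simp
  moreover have "r \<bullet> r = 2" "r \<bullet> s = -1" "r \<bullet> t = -1"
    using root_norm root_inner_of_root_sum[of r s] root_inner_of_root_sum[of r t] rst sums root_minus
    by (simp_all add: add.commute[of r t])
  ultimately have "scale (of_int (2 * N s t - N t r - N r s)) (e r) = 0"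
    using rst by (simp add: br_add_left br_scale_left br_h_e algebra_simps)
  then have "(of_int (2 * N s t - N t r - N r s) :: complex) = of_int 0"
    using e_nonzero[OF rst(1)] by (simp only: scale_eq_0_iff of_int_0) blast
  then show ?thesis
    by (simp only: of_int_eq_iff)
qed

text \<open>The three rotations of \<open>N_cyclic_aux\<close> say that each constant is the mean of
  the other two, so all three are equal.\<close>

lemma N_cyclic:
  assumes "r \<in> E6" "s \<in> E6" "t \<in> E6" "r + s + t = 0"
  shows "N s t = N r s"
  using N_cyclic_aux[of r s t] N_cyclic_aux[of s t r] N_cyclic_aux[of t r s] assms
  by (simp add: add_ac)

end

section \<open>The structure constants as a twisted coboundary\<close>

text \<open>
  Normalised to 1 at the simple roots; the value at the sum of an extraspecial pair \<open>(u, v)\<close> is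
  \<open>comb_sign u v\<close> times the values at \<open>u\<close> and \<open>v\<close> times the given constant of that pair.
\<close>

definition scaling_table ::
  "(nat \<Rightarrow> int) \<Rightarrow> (nat \<Rightarrow> int) \<Rightarrow> (nat \<Rightarrow> int) \<Rightarrow> (nat \<Rightarrow> int) \<Rightarrow> (nat \<Rightarrow> int) \<Rightarrow> (coeffs \<times> int) list" where
  "scaling_table \<alpha> \<beta> \<gamma> \<delta> \<epsilon> =
  [((1, 0, 0, 0, 0, 0), 1),
   ((0, 1, 0, 0, 0, 0), 1),
   ((0, 0, 1, 0, 0, 0), 1),
   ((0, 0, 0, 1, 0, 0), 1),
   ((0, 0, 0, 0, 1, 0), 1),
   ((0, 0, 0, 0, 0, 1), 1),
   ((1, 0, 1, 0, 0, 0), \<alpha> 1),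
   ((1, 0, 1, 1, 0, 0), \<alpha> 2 * \<beta> 1),
   ((1, 1, 1, 1, 0, 0), \<alpha> 3 * \<beta> 2 * \<gamma> 1),
   ((1, 0, 1, 1, 1, 0), - (\<alpha> 4 * \<beta> 3 * \<gamma> 2)),
   ((1, 1, 1, 1, 1, 0), \<alpha> 5 * \<beta> 4 * \<delta> 1 * \<gamma> 2),
   ((1, 1, 1, 2, 1, 0), - (\<alpha> 6 * \<beta> 4 * \<delta> 1 * \<gamma> 2 * \<gamma> 3)),
   ((1, 0, 1, 1, 1, 1), \<alpha> 7 * \<beta> 6 * \<epsilon> 1 * \<gamma> 4),
   ((1, 1, 1, 1, 1, 1), - (\<alpha> 8 * \<beta> 7 * \<delta> 2 * \<epsilon> 1 * \<gamma> 4)),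
   ((1, 1, 1, 2, 1, 1), \<alpha> 9 * \<beta> 7 * \<delta> 2 * \<epsilon> 1 * \<gamma> 4 * \<gamma> 5),
   ((1, 1, 1, 2, 2, 1), \<alpha> 0 * \<beta> 7 * \<delta> 2 * \<epsilon> 1 * \<epsilon> 2 * \<gamma> 4 * \<gamma> 5),
   ((0, 0, 1, 1, 0, 0), \<beta> 1),
   ((0, 1, 1, 1, 0, 0), \<beta> 2 * \<gamma> 1),
   ((0, 0, 1, 1, 1, 0), - (\<beta> 3 * \<gamma> 2)),
   ((0, 1, 1, 1, 1, 0), \<beta> 4 * \<delta> 1 * \<gamma> 2),
   ((1, 1, 2, 2, 1, 0), - (\<alpha> 6 * \<beta> 4 * \<beta> 5 * \<delta> 1 * \<gamma> 2 * \<gamma> 3)),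
   ((0, 0, 1, 1, 1, 1), \<beta> 6 * \<epsilon> 1 * \<gamma> 4),
   ((0, 1, 1, 1, 1, 1), - (\<beta> 7 * \<delta> 2 * \<epsilon> 1 * \<gamma> 4)),
   ((1, 1, 2, 2, 1, 1), \<alpha> 9 * \<beta> 7 * \<beta> 8 * \<delta> 2 * \<epsilon> 1 * \<gamma> 4 * \<gamma> 5),
   ((1, 1, 2, 2, 2, 1), \<alpha> 0 * \<beta> 7 * \<beta> 9 * \<delta> 2 * \<epsilon> 1 * \<epsilon> 2 * \<gamma> 4 * \<gamma> 5),
   ((0, 1, 0, 1, 0, 0), \<gamma> 1),
   ((0, 0, 0, 1, 1, 0), - (\<gamma> 2)),
   ((0, 1, 1, 2, 1, 0), - (\<beta> 4 * \<delta> 1 * \<gamma> 2 * \<gamma> 3)),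
   ((0, 0, 0, 1, 1, 1), \<epsilon> 1 * \<gamma> 4),
   ((0, 1, 1, 2, 1, 1), \<beta> 7 * \<delta> 2 * \<epsilon> 1 * \<gamma> 4 * \<gamma> 5),
   ((1, 1, 2, 3, 2, 1), \<alpha> 0 * \<beta> 7 * \<beta> 9 * \<delta> 2 * \<epsilon> 1 * \<epsilon> 2 * \<gamma> 4 * \<gamma> 5 * \<gamma> 6),
   ((0, 1, 0, 1, 1, 0), \<delta> 1 * \<gamma> 2),
   ((0, 1, 0, 1, 1, 1), - (\<delta> 2 * \<epsilon> 1 * \<gamma> 4)),
   ((1, 2, 2, 3, 2, 1), \<alpha> 0 * \<beta> 7 * \<beta> 9 * \<delta> 2 * \<delta> 3 * \<epsilon> 1 * \<epsilon> 2 * \<gamma> 4 * \<gamma> 5 * \<gamma> 6),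
   ((0, 0, 0, 0, 1, 1), - (\<epsilon> 1)),
   ((0, 1, 1, 2, 2, 1), \<beta> 7 * \<delta> 2 * \<epsilon> 1 * \<epsilon> 2 * \<gamma> 4 * \<gamma> 5)]"

definition scaling ::
  "(nat \<Rightarrow> int) \<Rightarrow> (nat \<Rightarrow> int) \<Rightarrow> (nat \<Rightarrow> int) \<Rightarrow> (nat \<Rightarrow> int) \<Rightarrow> (nat \<Rightarrow> int) \<Rightarrow> coeffs \<Rightarrow> int" where
  "scaling \<alpha> \<beta> \<gamma> \<delta> \<epsilon> u = the (map_of (scaling_table \<alpha> \<beta> \<gamma> \<delta> \<epsilon>) u)"

lemma scaling_keys: "map fst (scaling_table \<alpha> \<beta> \<gamma> \<delta> \<epsilon>) = pos_roots"
  by (simp add: scaling_table_def pos_roots_def)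

lemma distinct_pos_roots: "distinct pos_roots"
  by (simp add: pos_roots_def)

lemma scaling_eq: "(u, x) \<in> set (scaling_table \<alpha> \<beta> \<gamma> \<delta> \<epsilon>) \<Longrightarrow> scaling \<alpha> \<beta> \<gamma> \<delta> \<epsilon> u = x"
  by (simp add: scaling_def scaling_keys distinct_pos_roots)

text \<open>Unfolded, this supplies one rewrite rule for each positive root.\<close>

lemma scaling_values: "list_all (\<lambda>(u, x). scaling \<alpha> \<beta> \<gamma> \<delta> \<epsilon> u = x) (scaling_table \<alpha> \<beta> \<gamma> \<delta> \<epsilon>)"
  using scaling_eq unfolding list_all_iff by fast

text \<open>A computation with signs only, without the Lie algebra: entry by entry the values of k
  are multiplied out and squares are cancelled.\<close>

lemma table_eq:
  assumes "\<And>i. i \<le> 9 \<Longrightarrow> \<alpha> i * \<alpha> i = 1" "\<And>i. 1 \<le> i \<Longrightarrow> i \<le> 9 \<Longrightarrow> \<beta> i * \<beta> i = 1"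
    and "\<And>i. 1 \<le> i \<Longrightarrow> i \<le> 6 \<Longrightarrow> \<gamma> i * \<gamma> i = 1" "\<And>i. 1 \<le> i \<Longrightarrow> i \<le> 3 \<Longrightarrow> \<delta> i * \<delta> i = 1"
    and "\<And>i. 1 \<le> i \<Longrightarrow> i \<le> 2 \<Longrightarrow> \<epsilon> i * \<epsilon> i = 1"
  defines "k \<equiv> scaling \<alpha> \<beta> \<gamma> \<delta> \<epsilon>"
  shows "extraspecial_table \<alpha> \<beta> \<gamma> \<delta> \<epsilon> @ further_table \<alpha> \<beta> \<gamma> \<delta> \<epsilon> =
    map (\<lambda>(u, v). (comb u, comb v, comb_sign u v * k u * k v * k (u + v))) special_pairs"
proof -
  \<comment> \<open>Sorting products with \<open>mult_ac\<close> brings equal factors together;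
    these rules then remove them inside longer products.\<close>
  have cancel: "\<And>i x. i \<le> 9 \<Longrightarrow> \<alpha> i * (\<alpha> i * x) = x" "\<And>i x. 1 \<le> i \<Longrightarrow> i \<le> 9 \<Longrightarrow> \<beta> i * (\<beta> i * x) = x"
    "\<And>i x. 1 \<le> i \<Longrightarrow> i \<le> 6 \<Longrightarrow> \<gamma> i * (\<gamma> i * x) = x" "\<And>i x. 1 \<le> i \<Longrightarrow> i \<le> 3 \<Longrightarrow> \<delta> i * (\<delta> i * x) = x"
    "\<And>i x. 1 \<le> i \<Longrightarrow> i \<le> 2 \<Longrightarrow> \<epsilon> i * (\<epsilon> i * x) = x"
    using assms by (simp_all flip: mult.assoc)
  note k_values = scaling_values[of \<alpha> \<beta> \<gamma> \<delta> \<epsilon>, folded k_def, unfolded scaling_table_def list.pred_inject prod.case]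
  show ?thesis
    unfolding special_pairs_def list.map prod.case extraspecial_table_def further_table_def append.simps
    by (intro arg_cong2[where f = Cons] arg_cong2[where f = Pair] refl)
      (simp_all add: k_values comb.simps comb_sign_def euler_form_def assms(1-5) cancel mult_ac)
qed

lemma scaling_unit:
  assumes "\<And>i. i \<le> 9 \<Longrightarrow> \<alpha> i * \<alpha> i = 1" "\<And>i. 1 \<le> i \<Longrightarrow> i \<le> 9 \<Longrightarrow> \<beta> i * \<beta> i = 1"
    and "\<And>i. 1 \<le> i \<Longrightarrow> i \<le> 6 \<Longrightarrow> \<gamma> i * \<gamma> i = 1" "\<And>i. 1 \<le> i \<Longrightarrow> i \<le> 3 \<Longrightarrow> \<delta> i * \<delta> i = 1"
    and "\<And>i. 1 \<le> i \<Longrightarrow> i \<le> 2 \<Longrightarrow> \<epsilon> i * \<epsilon> i = 1"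
    and u: "u \<in> set pos_roots"
  defines "k \<equiv> scaling \<alpha> \<beta> \<gamma> \<delta> \<epsilon>"
  shows "k u * k u = 1"
proof -
  have cancel: "\<And>i x. i \<le> 9 \<Longrightarrow> \<alpha> i * (\<alpha> i * x) = x" "\<And>i x. 1 \<le> i \<Longrightarrow> i \<le> 9 \<Longrightarrow> \<beta> i * (\<beta> i * x) = x"
    "\<And>i x. 1 \<le> i \<Longrightarrow> i \<le> 6 \<Longrightarrow> \<gamma> i * (\<gamma> i * x) = x" "\<And>i x. 1 \<le> i \<Longrightarrow> i \<le> 3 \<Longrightarrow> \<delta> i * (\<delta> i * x) = x"
    "\<And>i x. 1 \<le> i \<Longrightarrow> i \<le> 2 \<Longrightarrow> \<epsilon> i * (\<epsilon> i * x) = x"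
    using assms by (simp_all flip: mult.assoc)
  have unit: "list_all (\<lambda>(u, x). x * x = 1) (scaling_table \<alpha> \<beta> \<gamma> \<delta> \<epsilon>)"
    unfolding scaling_table_def list.pred_inject prod.case
    by (intro conjI TrueI) (simp_all add: assms(1-5) cancel mult_ac)
  obtain x where "(u, x) \<in> set (scaling_table \<alpha> \<beta> \<gamma> \<delta> \<epsilon>)"
    using u unfolding scaling_keys[of \<alpha> \<beta> \<gamma> \<delta> \<epsilon>, symmetric] by auto
  then show ?thesis
    using scaling_eq unit unfolding k_def list_all_iff by fast
qed

section \<open>Extension from the extraspecial pairs by induction on height\<close>

context E6_chevalley
begin

definition coboundary :: "(coeffs \<Rightarrow> int) \<Rightarrow> coeffs \<Rightarrow> coeffs \<Rightarrow> bool" where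
  "coboundary k u v \<longleftrightarrow> N (comb u) (comb v) = comb_sign u v * k u * k v * k (u + v)"

text \<open>Both N and \<open>comb_sign\<close> change sign when u and v are exchanged, and the
  product of the values of k is symmetric.\<close>

lemma coboundary_swap:
  assumes "u \<in> set pos_roots" "v \<in> set pos_roots" "u + v \<in> set pos_roots" "coboundary k u v"
  shows "coboundary k v u"
proof -
  have "comb u \<in> E6" "comb v \<in> E6" "comb (u + v) \<in> E6"
    using assms(1-3) by (simp_all add: pos_root_iff)
  then show ?thesis
    using N_swap[of "comb u" "comb v"] comb_sign_swap[of u v] assms(4)
    by (simp add: coboundary_def comb_add add.commute mult_ac)
qed

text \<open>Three of the four constants in \<open>N_cocycle\<close> are known, and
  \<open>comb_sign\<close> satisfies the same identity, so the fourth follows. The Cartan integer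
  shows that x + z is not a root, and positivity that it is not 0.\<close>

lemma coboundary_step:
  assumes pos: "x \<in> set pos_roots" "y \<in> set pos_roots" "z \<in> set pos_roots"
      "x + y \<in> set pos_roots" "y + z \<in> set pos_roots" "x + y + z \<in> set pos_roots"
    and xz: "cartan_int x z \<noteq> -1"
    and unit: "\<And>u. u \<in> set pos_roots \<Longrightarrow> k u * k u = 1"
    and cob: "coboundary k x y" "coboundary k (x + y) z" "coboundary k y z"
  shows "coboundary k x (y + z)"
proof -
  have roots: "comb u \<in> E6" "u \<in> set root_list" if "u \<in> set pos_roots" for u
    using that by (simp_all add: pos_root_iff flip: comb_in_E6)
  have "comb (x + z) \<notin> E6"
    using cartan_int_of_root_sum[of x z] roots pos xz by (auto simp: comb_in_E6)
  moreover have "comb (x + z) \<noteq> 0"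
    using lex_pos_add[of x z] pos lex_pos_irrefl comb_cancel[of "x + z" 0] by (auto simp: pos_root_iff comb_0)
  ultimately have "N (comb x) (comb (y + z)) * N (comb y) (comb z) = N (comb x) (comb y) * N (comb (x + y)) (comb z)"
    using N_cocycle[of "comb x" "comb y" "comb z"] roots pos by (simp flip: comb_add)
  then have "N (comb x) (comb (y + z)) * (comb_sign y z * k y * k z * k (y + z)) =
      (comb_sign x y * comb_sign (x + y) z) * (k x * k y * k z * k (x + y + z)) * (k (x + y) * k (x + y))"
    using cob unfolding coboundary_def by (simp add: mult_ac)
  also have "\<dots> = (comb_sign x (y + z) * k x * k (y + z) * k (x + (y + z))) *
      (comb_sign y z * k y * k z * k (y + z)) * (k (y + z) * k (y + z))"
    using unit pos by (simp add: add.assoc flip: comb_sign_cocycle)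
  also have "\<dots> = (comb_sign x (y + z) * k x * k (y + z) * k (x + (y + z))) *
      (comb_sign y z * k y * k z * k (y + z))"
    using unit pos by simp
  \<comment> \<open>The common factor is nonzero because each of its factors has square 1.\<close>
  finally show ?thesis
    using unit[of y] unit[of z] unit[of "y + z"] pos comb_sign_square[of y z]
    unfolding coboundary_def by (auto simp: mult_cancel_right)
qed

lemma coboundary_pos_roots:
  assumes unit: "\<And>u. u \<in> set pos_roots \<Longrightarrow> k u * k u = 1"
    and ext: "\<And>u v. (u, v) \<in> set extraspecial_pairs \<Longrightarrow> coboundary k u v"
    and "u \<in> set pos_roots" "v \<in> set pos_roots" "u + v \<in> set pos_roots"
  shows "coboundary k u v"
  using assms(3-)
proof (induction "nat (height (u + v))" arbitrary: u v rule: less_induct)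
  case less
  \<comment> \<open>The induction hypothesis is made an assumption so that this can be applied to
    (u, v) as well as to (v, u).\<close>
  have special: "coboundary k u v"
    if sp: "(u, v) \<in> set special_pairs"
      and IH: "\<And>x y. x \<in> set pos_roots \<Longrightarrow> y \<in> set pos_roots \<Longrightarrow> x + y \<in> set pos_roots \<Longrightarrow>
        height (x + y) < height (u + v) \<Longrightarrow> coboundary k x y"
    for u v
  proof (cases "(u, v) \<in> set extraspecial_pairs")
    case False
    define u' v' where "u' = least_summand (u + v)" and "v' = u + v - u'"
    have uv: "u \<in> set pos_roots" "v \<in> set pos_roots" "u + v \<in> set pos_roots"
      using sp unfolding special_pairs_eq by auto
    have ext': "(u', v') \<in> set extraspecial_pairs"
      using extraspecial_pair_of_sum[OF sp] by (simp only: u'_def v'_def)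
    then have uv': "u' \<in> set pos_roots" "v' \<in> set pos_roots" "u' + v' \<in> set pos_roots"
      using extraspecial_imp_special unfolding special_pairs_eq by fastforce+
    \<comment> \<open>With q = y - u', the pairs (x, q) and (q, u') have sums v' and y of smaller
      height, while (v', u') is the extraspecial pair reversed. The roles of x and y are left open
      because the descent may occur on either side.\<close>
    have step: "coboundary k x y"
      if xy: "x \<in> set pos_roots" "y \<in> set pos_roots" "x + y = u + v" "y - u' \<in> set pos_roots" "cartan_int x u' \<noteq> -1"
      for x y
    proof -
      let ?q = "y - u'"
      have v': "x + ?q = v'"
        using xy(3) by (simp add: v'_def algebra_simps)
      have y: "?q + u' = y" by simp
      have sum: "u' + v' = u + v" by (simp add: v'_def)
      have "height (x + ?q) < height (u + v)"
        unfolding v' sum[symmetric] height_add using height_pos_roots[OF uv'(1)] by linarith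
      then have "coboundary k x ?q"
        using IH[of x ?q] xy(1,4) uv'(2) by (simp only: v')
      moreover have "height (?q + u') < height (u + v)"
        unfolding y xy(3)[symmetric] height_add using height_pos_roots[OF xy(1)] by linarith
      then have "coboundary k ?q u'"
        using IH[of ?q u'] xy(2,4) uv'(1) by (simp only: y)
      moreover have "coboundary k (x + ?q) u'"
        unfolding v' using coboundary_swap ext[OF ext'] uv' by blast
      moreover have "x + ?q + u' \<in> set pos_roots"
        using uv(3) by (simp add: v' v'_def)
      ultimately have "coboundary k x (?q + u')"
        using coboundary_step[of x ?q u' k] xy uv' unit by (simp only: v' y) blast
      then show ?thesis by simp
    qed
    from special_pair_descent[OF sp False] show ?thesis
      using step[of u v] step[of v u] coboundary_swap[of v u k] uv
      by (auto simp: add.commute simp flip: u'_def)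
  qed (rule ext)
  have IH: "coboundary k x y" if "x \<in> set pos_roots" "y \<in> set pos_roots" "x + y \<in> set pos_roots"
    "height (x + y) < height (u + v)" for x y
    using less.hyps[of x y] that height_pos_roots[of "u + v"] less.prems by simp
  consider "lex_pos (v - u)" | "v - u = 0" | "lex_pos (u - v)"
    using lex_pos_total[of "v - u"] by auto
  then show ?case
  proof cases
    case 1
    then show ?thesis
      using special[of u v] IH less.prems unfolding special_pairs_eq by blast
  next
    case 2
    \<comment> \<open>This case is impossible: the inner product of a root with itself would be both
      2 and -1.\<close>
    then have "comb v \<in> E6" "comb v + comb v \<in> E6"
      using less.prems by (simp_all add: pos_root_iff comb_add)
    then show ?thesis
      using root_norm[of "comb v"] root_inner_of_root_sum[of "comb v" "comb v"] by simp
  next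
    case 3
    then have "coboundary k v u"
      using special[of v u] IH less.prems unfolding special_pairs_eq by (simp add: add.commute)
    then show ?thesis
      using coboundary_swap[of v u k] less.prems by (simp add: add.commute)
  qed
qed

end

section \<open>The tables, the negative indices and the counts\<close>

lemma table_pairs_map: "table_pairs (map (\<lambda>(u, v). (comb u, comb v, x u v)) L) = comb_pair ` set L"
  unfolding table_pairs_def comb_pair_def by force

lemma length_special_pairs: "length special_pairs = 120"
  by (simp add: special_pairs_def)

lemma sign_square: "x \<in> {1, -1 :: int} \<Longrightarrow> x * x = 1"
  by auto

theorem theorem1:
  fixes scale :: "complex \<Rightarrow> 'g::ab_group_add \<Rightarrow> 'g"
    and br :: "'g \<Rightarrow> 'g \<Rightarrow> 'g"
    and H :: "'g set"
    and \<phi> :: "real^8 \<Rightarrow> 'g \<Rightarrow> complex"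
    and h e :: "real^8 \<Rightarrow> 'g"
    and N :: "real^8 \<Rightarrow> real^8 \<Rightarrow> int"
    and \<alpha> \<beta> \<gamma> \<delta> \<epsilon> :: "nat \<Rightarrow> int"
    and X T :: table
  assumes "X = extraspecial_table \<alpha> \<beta> \<gamma> \<delta> \<epsilon>"
    and "T = X @ further_table \<alpha> \<beta> \<gamma> \<delta> \<epsilon>"
    and "simple_lie_algebra scale br"
    and "lie_algebra.cartan_subalgebra scale br H"
    and "lie_algebra.E6_root_iso scale br H \<phi>"
    and "lie_algebra.chevalley_basis scale br H \<phi> h e"
    and "lie_algebra.structure_constants scale br e N"
    and "\<forall>i\<in>{0..9}. \<alpha> i \<in> {1, -1}"
    and "\<forall>i\<in>{1..9}. \<beta> i \<in> {1, -1}"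
    and "\<forall>i\<in>{1..6}. \<gamma> i \<in> {1, -1}"
    and "\<forall>i\<in>{1..3}. \<delta> i \<in> {1, -1}"
    and "\<forall>i\<in>{1..2}. \<epsilon> i \<in> {1, -1}"
    and "table_holds N X"
  shows
    "{(r, s). extraspecial r s} = table_pairs X \<and> card (table_pairs X) = 30 \<and>
     table_holds N T \<and> card (table_pairs T) = 120 \<and>
     {(r, s). r \<in> E6 \<and> s \<in> E6 \<and> 0 \<prec> r \<and> r \<prec> s \<and> N r s \<noteq> 0} = table_pairs T \<and>
     (\<forall>(p, q) \<in> table_pairs T. N p (- (p + q)) = - N p q \<and> N q (- (p + q)) = N p q) \<and>
     {(r, s). r \<in> E6 \<and> s \<in> E6 \<and> 0 \<prec> r \<and> r \<prec> s \<and> N r (- s) \<noteq> 0} =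
       (\<lambda>(p, q). (p, p + q)) ` table_pairs T \<union> (\<lambda>(p, q). (q, p + q)) ` table_pairs T \<and>
     card {(r, s). r \<in> E6 \<and> s \<in> E6 \<and> 0 \<prec> r \<and> r \<prec> s \<and> N r (- s) \<noteq> 0} = 240"
proof -
  interpret simple_lie_algebra scale br by fact
  have "subspace H"
    using assms(4) unfolding cartan_subalgebra_def nilpotent_subalgebra_def subalgebra_def by blast
  then interpret E6_chevalley scale br H \<phi> h e N
    using assms(5-7) by unfold_locales
  define k where "k = scaling \<alpha> \<beta> \<gamma> \<delta> \<epsilon>"
  have squares: "\<And>i. i \<le> 9 \<Longrightarrow> \<alpha> i * \<alpha> i = 1" "\<And>i. 1 \<le> i \<Longrightarrow> i \<le> 9 \<Longrightarrow> \<beta> i * \<beta> i = 1"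
    "\<And>i. 1 \<le> i \<Longrightarrow> i \<le> 6 \<Longrightarrow> \<gamma> i * \<gamma> i = 1" "\<And>i. 1 \<le> i \<Longrightarrow> i \<le> 3 \<Longrightarrow> \<delta> i * \<delta> i = 1"
    "\<And>i. 1 \<le> i \<Longrightarrow> i \<le> 2 \<Longrightarrow> \<epsilon> i * \<epsilon> i = 1"
    using assms(8-12) sign_square by simp_all
  let ?entry = "\<lambda>(u, v). (comb u, comb v, comb_sign u v * k u * k v * k (u + v))"
  have T: "T = map ?entry special_pairs"
    unfolding assms(1,2) k_def using squares by (rule table_eq)
  \<comment> \<open>The length identifies X with the first 30 entries of T, just as
    \<open>extraspecial_pairs\<close> is the initial part of \<open>special_pairs\<close>.\<close>
  have "length X = 30"
    unfolding assms(1) by (simp add: extraspecial_table_def)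
  then have "X = take 30 T"
    unfolding assms(2) by simp
  then have X: "X = map ?entry extraspecial_pairs"
    unfolding T extraspecial_pairs_def by (simp only: take_map)
  have table_iff: "table_holds N (map ?entry L) \<longleftrightarrow> (\<forall>(u, v) \<in> set L. coboundary k u v)" for L
    unfolding table_holds_def coboundary_def by auto
  have cob: "coboundary k u v" if "(u, v) \<in> set special_pairs" for u v
  proof (rule coboundary_pos_roots)
    show "k u * k u = 1" if "u \<in> set pos_roots" for u
      using squares that unfolding k_def by (rule scaling_unit)
    show "coboundary k u v" if "(u, v) \<in> set extraspecial_pairs" for u v
      using assms(13) that unfolding X table_iff by blast
  qed (use that in \<open>auto simp: special_pairs_eq\<close>)
  have pairs_X: "table_pairs X = comb_pair ` set extraspecial_pairs"
    unfolding X by (rule table_pairs_map)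
  have pairs_T: "table_pairs T = {(r, s). special r s}"
    unfolding T special_set by (rule table_pairs_map)
  have card_pairs: "card (comb_pair ` set L) = length L" if "distinct L" for L
    using that by (simp add: card_image distinct_card inj_on_subset[OF inj_comb_pair])
  have card_X: "card (table_pairs X) = 30"
    unfolding pairs_X using distinct_special_pairs length_special_pairs
    by (simp add: card_pairs extraspecial_pairs_def distinct_take)
  have card_T: "card (table_pairs T) = 120"
    unfolding pairs_T special_set using distinct_special_pairs length_special_pairs by (simp add: card_pairs)
  have N_nonzero: "N r s \<noteq> 0 \<longleftrightarrow> r + s \<in> E6" if "r \<in> E6" "s \<in> E6" "r + s \<noteq> 0" for r s
    using that N_unit[of r s] N_zero[of r s] by auto
  have prec_pos: "0 \<prec> r" "0 \<prec> s" "r + s \<noteq> 0" "r \<noteq> s" if rs: "r \<in> E6" "s \<in> E6" "0 \<prec> r" "r \<prec> s" for r s :: "real^8"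
  proof -
    obtain u v where uv: "r = comb u" "s = comb v" "u \<in> set pos_roots" "v \<in> set pos_roots" "lex_pos (v - u)"
      using rs by (rule prec_rootsE)
    then show "0 \<prec> s" "r + s \<noteq> 0" "r \<noteq> s"
      using prec_comb[of 0 v] lex_pos_add[of u v] lex_pos_irrefl comb_cancel[of "u + v" 0]
      by (auto simp: pos_root_iff comb_0 comb_add comb_cancel)
  qed (fact rs)
  have nonzero_T: "{(r, s). r \<in> E6 \<and> s \<in> E6 \<and> 0 \<prec> r \<and> r \<prec> s \<and> N r s \<noteq> 0} = table_pairs T"
    unfolding pairs_T special_def using N_nonzero prec_pos(3) by blast
  \<comment> \<open>Cyclic invariance is applied to the roots p, q, -(p + q), whose sum is
    0.\<close>
  have negative: "N p (- (p + q)) = - N p q \<and> N q (- (p + q)) = N p q" if "special p q" for p q :: "real^8"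
  proof -
    have pq: "p \<in> E6" "q \<in> E6" "p + q \<in> E6" "- (p + q) \<in> E6" "p + - (p + q) \<in> E6"
      using that root_minus[of q] root_minus[of "p + q"] unfolding special_def by (simp_all add: algebra_simps)
    have "N q (- (p + q)) = N p q"
      using N_cyclic[of p q "- (p + q)"] pq by simp
    moreover have "N p q = N (- (p + q)) p"
      using N_cyclic[of "- (p + q)" p q] pq by simp
    moreover have "N (- (p + q)) p = - N p (- (p + q))"
      using N_swap[of p "- (p + q)"] pq by blast
    ultimately show ?thesis by simp
  qed
  let ?f = "\<lambda>(p, q). (p, p + q) :: (real^8) \<times> (real^8)" and ?g = "\<lambda>(p, q). (q, p + q) :: (real^8) \<times> (real^8)"
  let ?S = "{(r, s). special r s}"
  have special_dest: "p \<in> E6" "q \<in> E6" "0 \<prec> p" "0 \<prec> q" "p \<prec> q" "p + q \<in> E6" "N p q \<noteq> 0" "p \<prec> p + q" "q \<prec> p + q"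
    if "special p q" for p q :: "real^8"
  proof -
    show pq: "p \<in> E6" "q \<in> E6" "0 \<prec> p" "p \<prec> q" "p + q \<in> E6"
      using that unfolding special_def by auto
    then show "0 \<prec> q" "N p q \<noteq> 0"
      using prec_pos N_nonzero by blast+
    \<comment> \<open>The order depends only on the difference, which is q or p.\<close>
    then show "p \<prec> p + q" "q \<prec> p + q"
      using pq(3) unfolding prec_def by simp_all
  qed
  \<comment> \<open>If r - s is a root, then s - r is a positive root. Depending on which of r and s
    - r comes first, (r, s) arises from the special pair (r, s - r) by \<open>?f\<close> or from (s
    - r, r) by \<open>?g\<close>; equality would make s twice a root.\<close>
  have nonzero_negative: "{(r, s). r \<in> E6 \<and> s \<in> E6 \<and> 0 \<prec> r \<and> r \<prec> s \<and> N r (- s) \<noteq> 0} = ?f ` ?S \<union> ?g ` ?S"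
    (is "?L = ?R")
  proof (intro equalityI subsetI)
    fix z assume "z \<in> ?L"
    then obtain r s :: "real^8" where z: "z = (r, s)" and rs: "r \<in> E6" "s \<in> E6" "0 \<prec> r" "r \<prec> s" "N r (- s) \<noteq> 0"
      by blast
    obtain u v where uv: "r = comb u" "s = comb v" "u \<in> set pos_roots" "v \<in> set pos_roots" "lex_pos (v - u)"
      using rs(1-4) by (rule prec_rootsE)
    have "r + - s \<in> E6"
      using N_nonzero[of r "- s"] rs root_minus prec_pos(4)[OF rs(1-4)] by simp
    then have w: "v - u \<in> set pos_roots"
      using root_minus[of "r + - s"] uv by (simp add: pos_root_iff comb_diff)
    consider "lex_pos (v - u - u)" | "v - u - u = 0" | "lex_pos (u - (v - u))"
      using lex_pos_total[of "v - u - u"] by (auto simp: algebra_simps)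
    then show "z \<in> ?R"
    proof cases
      case 1
      then have "special (comb u) (comb (v - u))"
        using uv w by (simp add: special_comb special_pairs_eq)
      then have "?f (comb u, comb (v - u)) \<in> ?f ` ?S" by blast
      then show ?thesis by (simp add: z uv(1,2) flip: comb_add)
    next
      case 2
      then have "v = u + u" by (simp add: algebra_simps)
      then have "comb u \<in> E6" "comb u + comb u \<in> E6"
        using uv by (simp_all add: pos_root_iff comb_add)
      then show ?thesis
        using root_norm[of "comb u"] root_inner_of_root_sum[of "comb u" "comb u"] by simp
    next
      case 3
      then have "special (comb (v - u)) (comb u)"
        using uv w by (simp add: special_comb special_pairs_eq)
      then have "?g (comb (v - u), comb u) \<in> ?g ` ?S" by blast
      then show ?thesis by (simp add: z uv(1,2) flip: comb_add)
    qed
  next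
    fix z assume "z \<in> ?R"
    then show "z \<in> ?L"
      using special_dest negative by fastforce
  qed
  \<comment> \<open>A common element would make both (p, q) and (q, p) special, hence p \<prec> q
    and q \<prec> p.\<close>
  have "?f ` ?S \<inter> ?g ` ?S = {}"
  proof -
    have False if pq: "special p q" "special q p" for p q
    proof -
      obtain u v where "p = comb u" "q = comb v"
        using special_dest(1,2)[OF pq(1)] unfolding E6_eq by blast
      then show False
        using special_dest(5)[OF pq(1)] special_dest(5)[OF pq(2)] lex_pos_minus[of "v - u"] by (simp add: prec_comb)
    qed
    then show ?thesis by (auto simp: add.commute)
  qed
  moreover have "inj_on ?f ?S" "inj_on ?g ?S"
    by (auto simp: inj_on_def)
  moreover have "finite ?S"
    by (simp add: special_set)
  ultimately have card_negative: "card (?f ` ?S \<union> ?g ` ?S) = 240"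
    using card_T unfolding pairs_T by (simp add: card_Un_disjoint card_image)
  show ?thesis
  proof (intro conjI)
    show "{(r, s). extraspecial r s} = table_pairs X"
      unfolding pairs_X by (rule extraspecial_set)
    show "table_holds N T"
      unfolding T table_iff using cob by blast
    show "\<forall>(p, q) \<in> table_pairs T. N p (- (p + q)) = - N p q \<and> N q (- (p + q)) = N p q"
      unfolding pairs_T using negative by blast
    show "card {(r, s). r \<in> E6 \<and> s \<in> E6 \<and> 0 \<prec> r \<and> r \<prec> s \<and> N r (- s) \<noteq> 0} = 240"
      unfolding nonzero_negative by (rule card_negative)
    show "{(r, s). r \<in> E6 \<and> s \<in> E6 \<and> 0 \<prec> r \<and> r \<prec> s \<and> N r (- s) \<noteq> 0} =
       (\<lambda>(p, q). (p, p + q)) ` table_pairs T \<union> (\<lambda>(p, q). (q, p + q)) ` table_pairs T"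
      unfolding pairs_T by (rule nonzero_negative)
  qed (fact card_X card_T nonzero_T)+
qed

end
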